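(* Let $\{G_i\}_{i\in I}$ be an HS-frame for $\mathcal{H}$ with respect to $\mathcal{K}$ with bounds $A,B$, and let $\{H_i\}_{i\in I}$ be a family of bounded linear operators from $\mathcal{H}$ into $\mathcal{C}_2(\mathcal{K})$. Suppose that for each real $k>0$ there exist constants $\lambda_1,\lambda_2\geq 0$ (which may depend on $k$) satisfying $\max\{\lambda_1,\lambda_2\}<\min\{1,2^{k-1}\}$ such that for every finite subset $J\subseteq I$ and all $A_i\in\mathcal{C}_2(\mathcal{K})$ $(i\in J)$, $$\Big\|\sum_{i\in J}(G_i^*A_i-H_i^*A_i)\Big\|^k\leq\lambda_1\Big\|\sum_{i\in J}G_i^*A_i\Big\|^k+\lambda_2\Big\|\sum_{i\in J}H_i^*A_i\Big\|^k.$$ Then $\{H_i\}_{i\in I}$ is an HS-frame for $\mathcal{H}$ with respect to $\mathcal{K}$, and for each $k>0$, with the corresponding constants $\lambda_1,\lambda_2$, it has (lower and upper, respectively) frame bounds $$A\left(\frac{1-c^{1/k}\lambda_1^{1/k}}{1+c^{1/k}\lambda_2^{1/k}}\right)^2\quad\text{and}\quad B\left(\frac{1+c^{1/k}\lambda_1^{1/k}}{1-c^{1/k}\lambda_2^{1/k}}\right)^2,$$ where $c=1$ if $k\geq 1$ and $c=2^{1-k}$ if $k\leq 1$.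
   Context: $\mathcal{H}$ and $\mathcal{K}$ are separable Hilbert spaces and $I$ is a countable index set. $\mathcal{C}_2(\mathcal{K})$ is the Hilbert-Schmidt class: all compact operators $T$ on $\mathcal{K}$ with $\sum_j\|Te_j\|^2<\infty$, where $\{e_j\}$ is an orthonormal basis of $\mathcal{K}$; it is a Hilbert space with inner product $[T,S]_{\mathrm{tr}}=\mathrm{trace}(S^*T)=\sum_j\langle Te_j,Se_j\rangle$ and norm $\|T\|_2=[T,T]_{\mathrm{tr}}^{1/2}$. For a bounded linear operator $G:\mathcal{H}\to\mathcal{C}_2(\mathcal{K})$, the adjoint $G^*:\mathcal{C}_2(\mathcal{K})\to\mathcal{H}$ is determined by $[Gx,T]_{\mathrm{tr}}=\langle x,G^*T\rangle$ for all $x\in\mathcal{H}$, $T\in\mathcal{C}_2(\mathcal{K})$. A family $\{G_i\}_{i\in I}$ of bounded linear operators from $\mathcal{H}$ into $\mathcal{C}_2(\mathcal{K})$ is a Hilbert-Schmidt frame (HS-frame) for $\mathcal{H}$ with respect to $\mathcal{K}$ with (frame) bounds $A,B$ if $A,B>0$ and $$A\|x\|^2\leq\sum_{i\in I}\|G_ix\|_2^2\leq B\|x\|^2\quad\text{for all }x\in\mathcal{H};$$ $A$ is the lower and $B$ the upper frame bound (bounds are not required to be optimal). The scalar $A$ (a frame bound) is unrelated to the operators $A_i\in\mathcal{C}_2(\mathcal{K})$. *)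

theory Defs
  imports "HOL-Analysis.Analysis"
begin

section \<open>Complex Hilbert spaces\<close>

text \<open>A complex inner product space. The inner product \<open>cinner\<close> is linear in its first and
  conjugate-linear in its second argument. The real inner product inherited from \<open>real_inner\<close>
  is its real part, so that norm x = sqrt (Re (cinner x x)) and the topology is the usual one.\<close>

class complex_inner = real_inner +
  fixes scaleC :: "complex \<Rightarrow> 'a \<Rightarrow> 'a"  (infixr \<open>*\<^sub>C\<close> 75)
    and cinner :: "'a \<Rightarrow> 'a \<Rightarrow> complex"
  assumes scaleC_add_right: "a *\<^sub>C (x + y) = a *\<^sub>C x + a *\<^sub>C y"
    and scaleC_add_left: "(a + b) *\<^sub>C x = a *\<^sub>C x + b *\<^sub>C x"
    and scaleC_scaleC: "a *\<^sub>C (b *\<^sub>C x) = (a * b) *\<^sub>C x"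
    and scaleC_of_real: "complex_of_real r *\<^sub>C x = r *\<^sub>R x"
    and cinner_commute: "cinner x y = cnj (cinner y x)"
    and cinner_add_left: "cinner (x + y) z = cinner x z + cinner y z"
    and cinner_scaleC_left: "cinner (a *\<^sub>C x) y = a * cinner x y"
    and inner_eq_Re_cinner: "inner x y = Re (cinner x y)"

class complex_hilbert = complex_inner + complete_space

global_interpretation cvec: vector_space "scaleC :: complex \<Rightarrow> 'a \<Rightarrow> 'a::complex_inner"
proof
  show "1 *\<^sub>C x = x" for x :: 'a
    using scaleC_of_real[of 1 x] by simp
qed (simp_all add: scaleC_add_right scaleC_add_left scaleC_scaleC)

definition is_onb :: "'k::complex_inner set \<Rightarrow> bool" where
  "is_onb E \<longleftrightarrow>
     (\<forall>e\<in>E. \<forall>f\<in>E. cinner e f = (if e = f then 1 else 0)) \<and> closure (cvec.span E) = UNIV"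

section \<open>The Hilbert-Schmidt class\<close>

definition compact_operator :: "('k::complex_inner \<Rightarrow> 'k) \<Rightarrow> bool" where
  "compact_operator T \<longleftrightarrow>
     Vector_Spaces.linear scaleC scaleC T \<and> compact (closure (T ` ball 0 1))"

text \<open>The Hilbert-Schmidt class, its inner product [T, S] = trace (S* T) and its norm, computed in
  an orthonormal basis \<open>E\<close>. None of them depends on the choice of \<open>E\<close>. Operators are plain functions,
  and \<open>hs_class E\<close> is used as a carrier set.\<close>

definition hs_class :: "'k::complex_inner set \<Rightarrow> ('k \<Rightarrow> 'k) set" where
  "hs_class E = {T. compact_operator T \<and> (\<lambda>e. (norm (T e))\<^sup>2) summable_on E}"

definition hs_inner :: "'k::complex_inner set \<Rightarrow> ('k \<Rightarrow> 'k) \<Rightarrow> ('k \<Rightarrow> 'k) \<Rightarrow> complex" where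
  "hs_inner E T S = (\<Sum>\<^sub>\<infinity>e\<in>E. cinner (T e) (S e))"

definition hs_norm :: "'k::complex_inner set \<Rightarrow> ('k \<Rightarrow> 'k) \<Rightarrow> real" where
  "hs_norm E T = sqrt (Re (hs_inner E T T))"

definition hs_bounded_linear ::
    "'k::complex_inner set \<Rightarrow> ('h::complex_inner \<Rightarrow> 'k \<Rightarrow> 'k) \<Rightarrow> bool" where
  "hs_bounded_linear E G \<longleftrightarrow>
     (\<forall>x. G x \<in> hs_class E) \<and>
     (\<forall>x y. G (x + y) = (\<lambda>u. G x u + G y u)) \<and>
     (\<forall>a x. G (a *\<^sub>C x) = (\<lambda>u. a *\<^sub>C G x u)) \<and>
     (\<exists>M. \<forall>x. hs_norm E (G x) \<le> M * norm x)"

text \<open>The adjoint, meaningful for bounded linear \<open>G\<close> and for \<open>T\<close> in the Hilbert-Schmidt class.\<close>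

definition hs_adjoint ::
    "'k::complex_inner set \<Rightarrow> ('h::complex_hilbert \<Rightarrow> 'k \<Rightarrow> 'k) \<Rightarrow> ('k \<Rightarrow> 'k) \<Rightarrow> 'h" where
  "hs_adjoint E G T = (THE y. \<forall>x. hs_inner E (G x) T = cinner x y)"

section \<open>Hilbert-Schmidt frames\<close>

definition hs_frame ::
    "'k::complex_inner set \<Rightarrow> 'i set \<Rightarrow> ('i \<Rightarrow> 'h::complex_inner \<Rightarrow> 'k \<Rightarrow> 'k) \<Rightarrow> real \<Rightarrow> real \<Rightarrow> bool"
  where
  "hs_frame E I G A B \<longleftrightarrow>
     A > 0 \<and> B > 0 \<and> (\<forall>i\<in>I. hs_bounded_linear E (G i)) \<and>
     (\<forall>x. (\<lambda>i. (hs_norm E (G i x))\<^sup>2) summable_on I \<and>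
          A * (norm x)\<^sup>2 \<le> (\<Sum>\<^sub>\<infinity>i\<in>I. (hs_norm E (G i x))\<^sup>2) \<and>
          (\<Sum>\<^sub>\<infinity>i\<in>I. (hs_norm E (G i x))\<^sup>2) \<le> B * (norm x)\<^sup>2)"

definition perturbation_constants ::
    "'k::complex_inner set \<Rightarrow> 'i set \<Rightarrow> ('i \<Rightarrow> 'h::complex_hilbert \<Rightarrow> 'k \<Rightarrow> 'k)
      \<Rightarrow> ('i \<Rightarrow> 'h \<Rightarrow> 'k \<Rightarrow> 'k) \<Rightarrow> real \<Rightarrow> real \<Rightarrow> real \<Rightarrow> bool"
  where
  "perturbation_constants E I G H k l1 l2 \<longleftrightarrow>
     0 \<le> l1 \<and> 0 \<le> l2 \<and> max l1 l2 < min 1 (2 powr (k - 1)) \<and>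
     (\<forall>J T. finite J \<and> J \<subseteq> I \<and> (\<forall>i\<in>J. T i \<in> hs_class E) \<longrightarrow>
        norm (\<Sum>i\<in>J. hs_adjoint E (G i) (T i) - hs_adjoint E (H i) (T i)) powr k
          \<le> l1 * norm (\<Sum>i\<in>J. hs_adjoint E (G i) (T i)) powr k
             + l2 * norm (\<Sum>i\<in>J. hs_adjoint E (H i) (T i)) powr k)"

definition pert_c :: "real \<Rightarrow> real" where
  "pert_c k = (if k \<ge> 1 then 1 else 2 powr (1 - k))"

end

theory Submission
  imports Defs
begin

text \<open>Write \<open>D\<^sub>G\<close> for the set of all finite sums \<open>\<Sum>i\<in>J. G\<^sub>i\<^sup>* T\<^sub>i\<close> with
  \<open>\<Sum>i\<in>J. \<parallel>T\<^sub>i\<parallel>\<^sup>2 \<le> 1\<close>. Since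
  \<open>Re \<langle>x, \<Sum>i\<in>J. G\<^sub>i\<^sup>* T\<^sub>i\<rangle> = \<Sum>i\<in>J. Re [G\<^sub>i x, T\<^sub>i]\<close>, the supremum of \<open>Re \<langle>x, d\<rangle>\<close>
  over \<open>d \<in> D\<^sub>G\<close> is \<open>(\<Sum>i. \<parallel>G\<^sub>i x\<parallel>\<^sup>2)\<^sup>1\<^sup>/\<^sup>2\<close>. Separating points from the closure of the convex set
  \<open>D\<^sub>G\<close> turns this into a description of frames without infinite sums
  (\<open>hs_frame_iff_unit_synthesis\<close>): \<open>G\<close> is a frame with bounds \<open>\<alpha>\<^sup>2\<close>, \<open>\<beta>\<^sup>2\<close> if and only if the open
  ball of radius \<open>\<alpha>\<close> lies in the closure of \<open>D\<^sub>G\<close>, and \<open>D\<^sub>G\<close> lies in the closed ball of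
  radius \<open>\<beta>\<close>. The theorem thus becomes a statement about the pairs
  \<open>(a, b) = (\<Sum>i\<in>J. G\<^sub>i\<^sup>* T\<^sub>i, \<Sum>i\<in>J. H\<^sub>i\<^sup>* T\<^sub>i)\<close>, which form a real subspace of \<open>\<H> \<times> \<H>\<close>.

  Taking \<open>k\<close>-th roots of the hypothesis yields \<open>\<parallel>a - b\<parallel> \<le> \<mu>\<^sub>1 \<parallel>a\<parallel> + \<mu>\<^sub>2 \<parallel>b\<parallel>\<close> with
  \<open>\<mu>\<^sub>j = (c \<lambda>\<^sub>j)\<^sup>1\<^sup>/\<^sup>k < 1\<close> (\<open>powr_inequality_linearized\<close>); the constant \<open>c\<close> is what it costs to
  compare \<open>u\<^sup>k + v\<^sup>k\<close> with \<open>(u + v)\<^sup>k\<close>. By the triangle inequality, the ratio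
  of \<open>\<parallel>b\<parallel>\<close> to \<open>\<parallel>a\<parallel>\<close> lies between \<open>(1 - \<mu>\<^sub>1) / (1 + \<mu>\<^sub>2)\<close> and \<open>(1 + \<mu>\<^sub>1) / (1 - \<mu>\<^sub>2)\<close>; this
  gives the upper bound.

  For the lower bound (\<open>ball_in_closure_image_perturbation\<close>), the first issue is that the vectors
  \<open>b\<close> be dense in \<open>\<H>\<close>. The vectors \<open>a\<close> are dense because \<open>G\<close> is a frame. On the segment
  \<open>z\<^sub>t = (1 - t) a + t b\<close> the norm \<open>\<parallel>a - b\<parallel>\<close> is at most a constant times \<open>\<parallel>z\<^sub>t\<parallel>\<close>, uniformly in
  \<open>t\<close>, so a small step in \<open>t\<close> changes \<open>z\<^sub>t\<close> by a small fraction of its norm and preserves density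
  of its range; finitely many steps lead from \<open>a\<close> to \<open>b\<close>. Once the \<open>b\<close> are dense, a vector \<open>y\<close>
  is approximated by some \<open>b\<^sub>0\<close>; its partner \<open>a\<^sub>0\<close> has controlled norm, hence is close to an
  \<open>a\<^sub>1\<close> that comes from a family of controlled norm, and comparability applied to
  \<open>(a\<^sub>1 - a\<^sub>0, b\<^sub>1 - b\<^sub>0)\<close> shows that \<open>b\<^sub>1\<close> is close to \<open>y\<close> as well.\<close>

section \<open>Projection and separation in Hilbert spaces\<close>

text \<open>The projection theorem. A minimising sequence for the distance is a Cauchy sequence by the
  parallelogram law, because midpoints stay in \<open>S\<close>; the inequality says that moving from the
  minimiser \<open>p\<close> towards another point of \<open>S\<close> does not decrease the distance to first order.\<close>
lemma closest_point_variational: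
  fixes x :: "'a::{real_inner,complete_space}"
  assumes "closed S" and "convex S" and "S \<noteq> {}"
  obtains p where "p \<in> S" and "\<And>y. y \<in> S \<Longrightarrow> inner (x - p) (y - p) \<le> 0"
proof -
  define d where "d = (INF y\<in>S. (norm (x - y))\<^sup>2)"
  have bdd: "bdd_below ((\<lambda>y. (norm (x - y))\<^sup>2) ` S)"
    by (rule bdd_belowI[of _ 0]) auto
  have d_le: "d \<le> (norm (x - y))\<^sup>2" if "y \<in> S" for y
    unfolding d_def by (rule cINF_lower[OF bdd that])
  have "\<exists>y\<in>S. (norm (x - y))\<^sup>2 < d + 1 / real (Suc n)" for n
    using cINF_less_iff[OF \<open>S \<noteq> {}\<close> bdd, of "d + 1 / real (Suc n)"] by (simp add: d_def)
  then obtain s where s: "\<And>n. s n \<in> S" and s_lt: "\<And>n. (norm (x - s n))\<^sup>2 < d + 1 / real (Suc n)"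
    by metis
  have dist_s: "(norm (s m - s n))\<^sup>2 \<le> 2 / real (Suc m) + 2 / real (Suc n)" for m n
  proof -
    have "(1/2) *\<^sub>R s m + (1/2) *\<^sub>R s n \<in> S"
      using \<open>convex S\<close> s by (intro convexD) auto
    then have "d \<le> (norm (x - ((1/2) *\<^sub>R s m + (1/2) *\<^sub>R s n)))\<^sup>2"
      by (rule d_le)
    moreover have "(norm (s m - s n))\<^sup>2 = 2 * (norm (x - s m))\<^sup>2 + 2 * (norm (x - s n))\<^sup>2
        - 4 * (norm (x - ((1/2) *\<^sub>R s m + (1/2) *\<^sub>R s n)))\<^sup>2"
      unfolding power2_norm_eq_inner by (simp add: algebra_simps inner_commute)
    ultimately show ?thesis
      using s_lt[of m] s_lt[of n] by simp
  qed
  have "Cauchy s"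
  proof (rule metric_CauchyI)
    fix e :: real assume "0 < e"
    then obtain N where N: "4 / e\<^sup>2 < real N"
      using reals_Archimedean2 by blast
    have "dist (s m) (s n) < e" if "m \<ge> N" "n \<ge> N" for m n
    proof -
      have "0 < real N"
        using N \<open>0 < e\<close> by (smt (verit) divide_pos_pos zero_less_power)
      then have "2 / real (Suc m) + 2 / real (Suc n) < 2 / real N + 2 / real N"
        using that by (intro add_strict_mono divide_strict_left_mono) auto
      also have "\<dots> < e\<^sup>2"
        using N \<open>0 < e\<close> \<open>0 < real N\<close> by (simp add: field_simps)
      finally have "(norm (s m - s n))\<^sup>2 < e\<^sup>2"
        using dist_s[of m n] by linarith
      then show ?thesis
        using \<open>0 < e\<close> by (simp add: dist_norm power_less_imp_less_base)
    qed
    then show "\<exists>M. \<forall>m\<ge>M. \<forall>n\<ge>M. dist (s m) (s n) < e" by blast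
  qed
  then obtain p where p: "s \<longlonglongrightarrow> p"
    using Cauchy_convergent convergent_def by blast
  have "p \<in> S"
    using closed_sequentially[OF \<open>closed S\<close> _ p] s by blast
  have "(\<lambda>n. d + 1 / real (Suc n)) \<longlonglongrightarrow> d + 0"
    by (intro tendsto_add tendsto_const LIMSEQ_Suc[OF lim_1_over_n])
  moreover have "(\<lambda>n. (norm (x - s n))\<^sup>2) \<longlonglongrightarrow> (norm (x - p))\<^sup>2"
    by (intro tendsto_intros p)
  ultimately have p_le: "(norm (x - p))\<^sup>2 \<le> d"
    using LIMSEQ_le s_lt less_imp_le by (metis (no_types, lifting) add.right_neutral)
  have "inner (x - p) (y - p) \<le> 0" if "y \<in> S" for y
  proof (rule ccontr)
    define a where "a = inner (x - p) (y - p)"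
    assume "\<not> inner (x - p) (y - p) \<le> 0"
    then have "a > 0" by (simp add: a_def)
    define b where "b = (norm (y - p))\<^sup>2"
    have "b \<ge> 0" by (simp add: b_def)
    define t where "t = min 1 (a / (b + 1))"
    have t: "0 < t" "t \<le> 1" and "t \<le> a / (b + 1)"
      using \<open>a > 0\<close> \<open>b \<ge> 0\<close> by (auto simp: t_def)
    then have tb: "t * (b + 1) \<le> a"
      using \<open>b \<ge> 0\<close> by (simp add: pos_le_divide_eq)
    have "(1 - t) *\<^sub>R p + t *\<^sub>R y \<in> S"
      using \<open>convex S\<close> \<open>p \<in> S\<close> that t by (intro convexD) auto
    then have "(norm (x - p))\<^sup>2 \<le> (norm (x - ((1 - t) *\<^sub>R p + t *\<^sub>R y)))\<^sup>2"
      using order_trans[OF p_le d_le] by blast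
    also have "x - ((1 - t) *\<^sub>R p + t *\<^sub>R y) = (x - p) - t *\<^sub>R (y - p)"
      by (simp add: algebra_simps)
    also have "(norm \<dots>)\<^sup>2 = (norm (x - p))\<^sup>2 - 2 * t * a + t * t * b"
      unfolding power2_norm_eq_inner a_def b_def
      by (simp only: inner_diff_left inner_diff_right inner_scaleR_left inner_scaleR_right)
         (simp add: inner_commute algebra_simps)
    finally have "t * (2 * a) \<le> t * (t * b)" by simp
    then have "2 * a \<le> t * b" using t by simp
    then show False using t tb \<open>a > 0\<close> by (simp add: algebra_simps)
  qed
  then show thesis using that \<open>p \<in> S\<close> by blast
qed

text \<open>The separating functional is the inner product with \<open>x - p\<close>, where \<open>p\<close> is the point of
  \<open>closure C\<close> closest to \<open>x\<close>.\<close>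
lemma separation_from_closure:
  fixes x :: "'a::{real_inner,complete_space}"
  assumes "convex C" and "x \<notin> closure C"
  obtains w m where "\<forall>y\<in>C. inner w y \<le> m" and "m < inner w x"
proof (cases "C = {}")
  case True
  then show thesis using that[of 0 "-1"] by simp
next
  case False
  then obtain p where p: "p \<in> closure C"
      and var: "\<And>y. y \<in> closure C \<Longrightarrow> inner (x - p) (y - p) \<le> 0"
    using closest_point_variational[of "closure C" x] \<open>convex C\<close> convex_closure by auto
  show thesis
  proof (rule that)
    show "\<forall>y\<in>C. inner (x - p) y \<le> inner (x - p) p"
      using var closure_subset by (fastforce simp: inner_diff_right)
    have "0 < inner (x - p) (x - p)"
      using p assms(2) by auto
    then show "inner (x - p) p < inner (x - p) x"
      by (simp add: inner_diff_right)
  qed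
qed

text \<open>A linear functional that is bounded above on a subspace vanishes there.\<close>
lemma orthogonal_vector_if_not_dense:
  fixes R :: "'a::{real_inner,complete_space} set"
  assumes "subspace R" and "closure R \<noteq> UNIV"
  obtains w where "w \<noteq> 0" and "\<And>y. y \<in> R \<Longrightarrow> inner w y = 0"
proof -
  obtain x where "x \<notin> closure R" using assms(2) by auto
  then obtain w m where m: "\<forall>y\<in>R. inner w y \<le> m" and x: "m < inner w x"
    using separation_from_closure subspace_imp_convex[OF assms(1)] by metis
  have "m \<ge> 0" using m subspace_0[OF assms(1)] by force
  show thesis
  proof (rule that)
    show "w \<noteq> 0" using x \<open>m \<ge> 0\<close> by auto
    show "inner w y = 0" if "y \<in> R" for y
    proof (rule ccontr)
      assume "inner w y \<noteq> 0"
      then show False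
        using bspec[OF m subspace_scale[OF assms(1) that, of "(m + 1) / inner w y"]] by simp
    qed
  qed
qed

section \<open>Complex inner products and the Riesz representation theorem\<close>

lemma cinner_add_right: "cinner x (y + z) = cinner x y + cinner x z"
  by (metis cinner_add_left cinner_commute complex_cnj_add)

lemma cinner_scaleC_right: "cinner x (a *\<^sub>C y) = cnj a * cinner x y"
  by (metis cinner_commute cinner_scaleC_left complex_cnj_mult)

lemma cinner_scaleR_right: "cinner x (r *\<^sub>R y) = of_real r * cinner x y"
  by (simp add: scaleC_of_real[symmetric] cinner_scaleC_right)

lemma cinner_zero_right: "cinner x 0 = 0"
  using cinner_scaleR_right[of x 0 0] by simp

lemma cinner_self: "cinner x x = of_real ((norm x)\<^sup>2)"
proof (rule complex_eqI)
  show "Re (cinner x x) = Re (of_real ((norm x)\<^sup>2))"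
    by (simp add: inner_eq_Re_cinner[symmetric] power2_norm_eq_inner)
  show "Im (cinner x x) = Im (of_real ((norm x)\<^sup>2))"
    using arg_cong[OF cinner_commute[of x x], of Im] by simp
qed

text \<open>The representing vector is a multiple of a vector \<open>w\<close> orthogonal to the kernel, because
  \<open>f w *\<^sub>R x - f x *\<^sub>R w\<close> always lies in the kernel.\<close>
lemma riesz_real:
  fixes f :: "'a::{real_inner,complete_space} \<Rightarrow> real"
  assumes "bounded_linear f"
  obtains y where "\<And>x. f x = inner x y"
proof (cases "\<forall>x. f x = 0")
  case True
  then show thesis using that[of 0] by simp
next
  case False
  interpret f: bounded_linear f by fact
  define N where "N = {x. f x = 0}"
  have "subspace N"
    by (auto simp: N_def subspace_def f.add f.scaleR f.zero)
  moreover have "closed N"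
    unfolding N_def by (intro closed_Collect_eq f.continuous_on continuous_on_id continuous_on_const)
  moreover have "N \<noteq> UNIV" using False by (auto simp: N_def)
  ultimately obtain w where w: "w \<noteq> 0" "\<And>y. y \<in> N \<Longrightarrow> inner w y = 0"
    using orthogonal_vector_if_not_dense[of N] by auto
  then have "w \<notin> N" using inner_eq_zero_iff by blast
  then have "f w \<noteq> 0" by (simp add: N_def)
  show thesis
  proof (rule that)
    fix x
    have "f w *\<^sub>R x - f x *\<^sub>R w \<in> N"
      by (simp add: N_def f.diff f.scaleR)
    then have "f w * inner w x = f x * inner w w"
      using w(2) by (fastforce simp: inner_diff_right)
    then show "f x = inner x ((f w / inner w w) *\<^sub>R w)"
      using w(1) by (simp add: inner_commute field_simps)
  qed
qed

text \<open>A complex-linear functional is determined by its real part, through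
  \<open>Im (f x) = - Re (f (\<i> *\<^sub>C x))\<close>, so the vector that represents the real part represents \<open>f\<close>.\<close>
lemma riesz_complex:
  fixes f :: "'a::complex_hilbert \<Rightarrow> complex"
  assumes add: "\<And>x y. f (x + y) = f x + f y"
    and scale: "\<And>a x. f (a *\<^sub>C x) = a * f x"
    and bound: "\<And>x. \<bar>Re (f x)\<bar> \<le> M * norm x"
  obtains y where "\<And>x. f x = cinner x y"
proof -
  have "bounded_linear (\<lambda>x. Re (f x))"
  proof (rule bounded_linear_intro)
    show "Re (f (r *\<^sub>R x)) = r *\<^sub>R Re (f x)" for r x
      by (simp add: scale scaleC_of_real[symmetric])
    show "norm (Re (f x)) \<le> norm x * M" for x
      using bound[of x] by (simp add: mult.commute)
  qed (simp add: add)
  then obtain y where y: "\<And>x. Re (f x) = inner x y"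
    using riesz_real[of "\<lambda>x. Re (f x)"] by auto
  show thesis
  proof (rule that)
    fix x
    show "f x = cinner x y"
    proof (rule complex_eqI)
      show "Re (f x) = Re (cinner x y)"
        by (simp add: y inner_eq_Re_cinner)
      show "Im (f x) = Im (cinner x y)"
        using y[of "\<i> *\<^sub>C x"] by (simp add: scale inner_eq_Re_cinner cinner_scaleC_left)
    qed
  qed
qed

section \<open>Perturbation of dense ranges\<close>

text \<open>A nonzero \<open>w\<close> orthogonal to all \<open>v\<close> cannot be approximated by the \<open>u\<close>: if \<open>u\<close> is close to
  \<open>w\<close>, then \<open>\<langle>w, u - v\<rangle> = \<langle>w, u\<rangle>\<close> is close to \<open>\<parallel>w\<parallel>\<^sup>2\<close>, yet it is at most about
  \<open>\<theta> \<parallel>w\<parallel>\<^sup>2\<close>.\<close>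
lemma dense_image_small_perturbation:
  fixes P :: "('a::{real_inner,complete_space} \<times> 'a) set"
  assumes P: "subspace P" and \<theta>: "0 \<le> \<theta>" "\<theta> < 1"
    and close: "\<And>u v. (u, v) \<in> P \<Longrightarrow> norm (u - v) \<le> \<theta> * norm u"
    and dense: "closure (fst ` P) = UNIV"
  shows "closure (snd ` P) = UNIV"
proof (rule ccontr)
  assume "closure (snd ` P) \<noteq> UNIV"
  then obtain w where "w \<noteq> 0" and orth: "\<And>v. v \<in> snd ` P \<Longrightarrow> inner w v = 0"
    using orthogonal_vector_if_not_dense linear_subspace_image[OF linear_snd P] by blast
  \<comment> \<open>Chosen so that \<open>\<epsilon> + \<theta> * (1 + \<epsilon>)\<close> is the midpoint of \<open>\<theta>\<close> and \<open>1\<close>.\<close>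
  define \<epsilon> where "\<epsilon> = (1 - \<theta>) / (2 * (1 + \<theta>))"
  have \<epsilon>: "\<epsilon> > 0" "\<epsilon> + \<theta> * (1 + \<epsilon>) < 1"
  proof -
    show "\<epsilon> > 0" using \<theta> by (simp add: \<epsilon>_def)
    have "\<epsilon> * (1 + \<theta>) = (1 - \<theta>) / 2"
      using \<theta> by (simp add: \<epsilon>_def field_simps)
    then show "\<epsilon> + \<theta> * (1 + \<epsilon>) < 1"
      using \<theta> by (simp add: algebra_simps)
  qed
  have "\<epsilon> * norm w > 0" using \<epsilon> \<open>w \<noteq> 0\<close> by simp
  moreover have "w \<in> closure (fst ` P)" using dense by simp
  ultimately obtain u v where uv: "(u, v) \<in> P" "norm (u - w) < \<epsilon> * norm w"
    unfolding closure_approachable dist_norm by force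
  have "norm u \<le> (1 + \<epsilon>) * norm w"
    using uv(2) norm_triangle_ineq[of "u - w" w] by (simp add: algebra_simps)
  then have uv_diff: "norm (u - v) \<le> \<theta> * ((1 + \<epsilon>) * norm w)"
    using close[OF uv(1)] \<theta> by (meson mult_left_mono order_trans)
  have "inner w v = 0" using orth uv(1) by force
  then have "norm w * norm w = inner w (w - u) + inner w (u - v)"
    by (simp add: inner_diff_right norm_eq_sqrt_inner)
  also have "\<dots> \<le> norm w * norm (w - u) + norm w * norm (u - v)"
    by (intro add_mono norm_cauchy_schwarz)
  also have "\<dots> \<le> norm w * (\<epsilon> * norm w) + norm w * (\<theta> * ((1 + \<epsilon>) * norm w))"
    using uv(2) uv_diff by (intro add_mono mult_left_mono) (auto simp: norm_minus_commute)
  also have "\<dots> = (\<epsilon> + \<theta> * (1 + \<epsilon>)) * (norm w * norm w)"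
    by (simp add: algebra_simps)
  also have "\<dots> < 1 * (norm w * norm w)"
    using \<epsilon> \<open>w \<noteq> 0\<close> by (intro mult_strict_right_mono) auto
  finally show False by simp
qed

text \<open>The method of continuity. A single comparison of \<open>a\<close> and \<open>b\<close> does not suffice, since
  \<open>\<mu>\<close> may be close to \<open>1\<close>; instead \<open>a\<close> is moved to \<open>b\<close> in \<open>n\<close> steps, each of which is a small
  perturbation. The constant \<open>K\<close> bounds \<open>\<parallel>a - b\<parallel>\<close> relative to every point of the segment from
  \<open>a\<close> to \<open>b\<close>, so that \<open>n > K\<close> steps are enough.\<close>
lemma dense_image_perturbation:
  fixes P :: "('a::{real_inner,complete_space} \<times> 'a) set"
  assumes P: "subspace P" and \<mu>: "0 \<le> \<mu>" "\<mu> < 1"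
    and close: "\<And>a b. (a, b) \<in> P \<Longrightarrow> norm (a - b) \<le> \<mu> * norm a + \<mu> * norm b"
    and dense: "closure (fst ` P) = UNIV"
  shows "closure (snd ` P) = UNIV"
proof -
  define z :: "real \<Rightarrow> 'a \<times> 'a \<Rightarrow> 'a" where "z t q = (1 - t) *\<^sub>R fst q + t *\<^sub>R snd q" for t q
  define K where "K = 2 * \<mu> / (1 - \<mu>)"
  have "K \<ge> 0" using \<mu> by (simp add: K_def)
  have diff_le: "norm (fst q - snd q) \<le> K * norm (z t q)" if "q \<in> P" "0 \<le> t" "t \<le> 1" for q t
  proof -
    let ?d = "fst q - snd q"
    have "norm (fst q) = norm (z t q + t *\<^sub>R ?d)"
      by (simp add: z_def algebra_simps)
    also have "\<dots> \<le> norm (z t q) + t * norm ?d"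
      using norm_triangle_ineq[of "z t q" "t *\<^sub>R ?d"] that by simp
    finally have 1: "norm (fst q) \<le> norm (z t q) + t * norm ?d" .
    have "norm (snd q) = norm (z t q - (1 - t) *\<^sub>R ?d)"
      by (simp add: z_def algebra_simps)
    also have "\<dots> \<le> norm (z t q) + (1 - t) * norm ?d"
      using norm_triangle_ineq4[of "z t q" "(1 - t) *\<^sub>R ?d"] that by simp
    finally have 2: "norm (snd q) \<le> norm (z t q) + (1 - t) * norm ?d" .
    have "norm ?d \<le> \<mu> * (norm (fst q) + norm (snd q))"
      using close[of "fst q" "snd q"] that by (simp add: algebra_simps)
    also have "\<dots> \<le> \<mu> * (2 * norm (z t q) + norm ?d)"
      using 1 2 \<mu> by (intro mult_left_mono) (auto simp: algebra_simps)
    finally show ?thesis using \<mu> by (simp add: K_def field_simps)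
  qed
  have z_linear: "linear (z t)" for t
    by (rule linearI) (auto simp: z_def algebra_simps)
  obtain n :: nat where n: "K < real n" using reals_Archimedean2 by blast
  then have "n > 0" using \<open>K \<ge> 0\<close> by (auto intro: gr0I)
  have "closure (z (real j / real n) ` P) = UNIV" if "j \<le> n" for j
    using that
  proof (induction j)
    case 0
    have "z (real 0 / real n) = fst" by (auto simp: z_def)
    then show ?case using dense by simp
  next
    case (Suc j)
    define t s where "t = real j / real n" and "s = real (Suc j) / real n"
    have t: "0 \<le> t" "t \<le> 1" using Suc.prems by (auto simp: t_def)
    have st: "s - t = 1 / real n" by (simp add: s_def t_def diff_divide_distrib[symmetric])
    define Q where "Q = (\<lambda>q. (z t q, z s q)) ` P"
    have fst_Q: "fst ` Q = z t ` P" and snd_Q: "snd ` Q = z s ` P"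
      by (auto simp: Q_def image_image)
    have "closure (snd ` Q) = UNIV"
    proof (rule dense_image_small_perturbation)
      show "subspace Q"
        unfolding Q_def
        by (intro linear_subspace_image P linearI)
           (auto simp: linear_add[OF z_linear] linear_scale[OF z_linear])
      show "0 \<le> K / real n" "K / real n < 1"
        using \<open>K \<ge> 0\<close> n \<open>n > 0\<close> by auto
      show "closure (fst ` Q) = UNIV"
        unfolding fst_Q t_def using Suc by simp
      fix u v assume "(u, v) \<in> Q"
      then obtain q where q: "q \<in> P" "u = z t q" "v = z s q" by (auto simp: Q_def)
      have "u - v = (s - t) *\<^sub>R (fst q - snd q)"
        unfolding q by (simp add: z_def algebra_simps)
      then have "norm (u - v) = norm (fst q - snd q) / real n"
        unfolding st by simp
      also have "\<dots> \<le> K * norm u / real n"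
        using diff_le[OF q(1) t] \<open>n > 0\<close> by (simp add: q divide_right_mono)
      finally show "norm (u - v) \<le> K / real n * norm u" by simp
    qed
    then show ?case unfolding snd_Q s_def .
  qed
  from this[of n] \<open>n > 0\<close> have "closure (z 1 ` P) = UNIV" by simp
  moreover have "z 1 = snd" by (auto simp: z_def)
  ultimately show ?thesis by simp
qed

lemma norm_le_perturbed_norm:
  fixes a b :: "'a::real_normed_vector"
  assumes "norm (a - b) \<le> \<mu>\<^sub>1 * norm a + \<mu>\<^sub>2 * norm b" and "\<mu>\<^sub>2 < 1"
  shows "norm b \<le> (1 + \<mu>\<^sub>1) / (1 - \<mu>\<^sub>2) * norm a"
proof -
  have "(1 - \<mu>\<^sub>2) * norm b \<le> (1 + \<mu>\<^sub>1) * norm a"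
    using assms(1) norm_triangle_ineq2[of b a] by (simp add: algebra_simps norm_minus_commute)
  then show ?thesis using assms(2) by (simp add: pos_le_divide_eq mult.commute)
qed

text \<open>In the application \<open>P\<close> consists of the pairs of synthesised vectors and \<open>C\<close> of those that
  come from families in the unit ball. Density of \<open>snd ` P\<close> is used only qualitatively: the
  preimages it provides are uncontrolled, and are exchanged for elements of \<open>C\<close> by approximating
  their first components, which keeps the radius sharp.\<close>
lemma ball_in_closure_image_perturbation:
  fixes P C :: "('a::{real_inner,complete_space} \<times> 'a) set"
  assumes P: "subspace P" and "C \<subseteq> P"
    and \<mu>: "0 \<le> \<mu>\<^sub>1" "\<mu>\<^sub>1 < 1" "0 \<le> \<mu>\<^sub>2" "\<mu>\<^sub>2 < 1"
    and close: "\<And>a b. (a, b) \<in> P \<Longrightarrow> norm (a - b) \<le> \<mu>\<^sub>1 * norm a + \<mu>\<^sub>2 * norm b"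
    and r: "r > 0" and ball: "ball 0 r \<subseteq> closure (fst ` C)"
  shows "ball 0 (r * ((1 - \<mu>\<^sub>1) / (1 + \<mu>\<^sub>2))) \<subseteq> closure (snd ` C)"
proof
  define \<rho> where "\<rho> = (1 + \<mu>\<^sub>2) / (1 - \<mu>\<^sub>1)"
  define \<sigma> where "\<sigma> = (1 + \<mu>\<^sub>1) / (1 - \<mu>\<^sub>2)"
  have pos: "\<rho> > 0" "\<sigma> > 0" using \<mu> by (auto simp: \<rho>_def \<sigma>_def)
  have fst_le: "norm a \<le> \<rho> * norm b" and snd_le: "norm b \<le> \<sigma> * norm a" if "(a, b) \<in> P" for a b
    using norm_le_perturbed_norm[of b a \<mu>\<^sub>2 \<mu>\<^sub>1] norm_le_perturbed_norm[of a b \<mu>\<^sub>1 \<mu>\<^sub>2]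
      close[OF that] \<mu> by (simp_all add: \<rho>_def \<sigma>_def norm_minus_commute)
  \<comment> \<open>A subspace whose closure contains a ball admits no nonzero orthogonal vector.\<close>
  have "closure (fst ` P) = UNIV"
  proof (rule ccontr)
    assume "closure (fst ` P) \<noteq> UNIV"
    then obtain w where "w \<noteq> 0" and orth: "\<And>v. v \<in> fst ` P \<Longrightarrow> inner w v = 0"
      using orthogonal_vector_if_not_dense linear_subspace_image[OF linear_fst P] by blast
    define v where "v = (r / (2 * norm w)) *\<^sub>R w"
    have "v \<in> ball 0 r" using \<open>w \<noteq> 0\<close> r by (simp add: v_def)
    then have "v \<in> closure (fst ` P)"
      using ball closure_mono[OF image_mono[OF \<open>C \<subseteq> P\<close>]] by blast
    moreover have "closure (fst ` P) \<subseteq> {v. inner w v = 0}"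
      using orth by (intro closure_minimal closed_Collect_eq continuous_intros) auto
    ultimately have "inner w v = 0" by auto
    then show False using \<open>w \<noteq> 0\<close> r by (simp add: v_def)
  qed
  moreover have "norm (a - b) \<le> max \<mu>\<^sub>1 \<mu>\<^sub>2 * norm a + max \<mu>\<^sub>1 \<mu>\<^sub>2 * norm b" if "(a, b) \<in> P" for a b
  proof -
    have "\<mu>\<^sub>1 * norm a \<le> max \<mu>\<^sub>1 \<mu>\<^sub>2 * norm a" "\<mu>\<^sub>2 * norm b \<le> max \<mu>\<^sub>1 \<mu>\<^sub>2 * norm b"
      by (intro mult_right_mono; simp)+
    then show ?thesis using close[OF that] by linarith
  qed
  ultimately have dense: "closure (snd ` P) = UNIV"
    using dense_image_perturbation[OF P, of "max \<mu>\<^sub>1 \<mu>\<^sub>2"] \<mu> by auto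
  fix y :: 'a assume "y \<in> ball 0 (r * ((1 - \<mu>\<^sub>1) / (1 + \<mu>\<^sub>2)))"
  then have y: "norm y < r / \<rho>" by (simp add: \<rho>_def)
  show "y \<in> closure (snd ` C)"
    unfolding closure_approachable
  proof (intro allI impI)
    fix e :: real assume "e > 0"
    \<comment> \<open>The second bound keeps the norm of \<open>b\<^sub>0\<close> below \<open>r / \<rho>\<close>, hence that of \<open>a\<^sub>0\<close> below \<open>r\<close>.\<close>
    define e' where "e' = min (e / 2) (r / \<rho> - norm y)"
    have "e' > 0" using \<open>e > 0\<close> y by (simp add: e'_def)
    moreover have "y \<in> closure (snd ` P)" using dense by simp
    ultimately obtain a\<^sub>0 b\<^sub>0 where 0: "(a\<^sub>0, b\<^sub>0) \<in> P" "norm (b\<^sub>0 - y) < e'"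
      unfolding closure_approachable dist_norm by force
    have "norm b\<^sub>0 < r / \<rho>"
      using 0(2) norm_triangle_ineq[of "b\<^sub>0 - y" y] by (simp add: e'_def)
    then have "norm a\<^sub>0 < r"
      using fst_le[OF 0(1)] pos by (simp add: field_simps)
    then have "a\<^sub>0 \<in> closure (fst ` C)" using ball by auto
    moreover have "e / (2 * \<sigma>) > 0" using \<open>e > 0\<close> pos by simp
    ultimately obtain a\<^sub>1 b\<^sub>1 where 1: "(a\<^sub>1, b\<^sub>1) \<in> C" "norm (a\<^sub>1 - a\<^sub>0) < e / (2 * \<sigma>)"
      unfolding closure_approachable dist_norm by force
    have "(a\<^sub>1 - a\<^sub>0, b\<^sub>1 - b\<^sub>0) \<in> P"
      using subspace_diff[OF P _ 0(1), of "(a\<^sub>1, b\<^sub>1)"] 1(1) \<open>C \<subseteq> P\<close> by auto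
    then have "norm (b\<^sub>1 - b\<^sub>0) \<le> \<sigma> * norm (a\<^sub>1 - a\<^sub>0)" by (rule snd_le)
    also have "\<dots> < e / 2" using 1(2) pos by (simp add: field_simps)
    finally have "dist b\<^sub>1 y < e"
      using 0(2) norm_triangle_ineq[of "b\<^sub>1 - b\<^sub>0" "b\<^sub>0 - y"] by (simp add: dist_norm e'_def)
    then show "\<exists>x\<in>snd ` C. dist x y < e" using 1(1) by force
  qed
qed

section \<open>Taking roots in the perturbation inequality\<close>

text \<open>For \<open>k \<ge> 1\<close> this is superadditivity of the power: \<open>w\<^sup>k \<le> w\<close> for the fractions
  \<open>w = u / (u + v)\<close> and \<open>w = v / (u + v)\<close>, which add up to \<open>1\<close>. For \<open>k < 1\<close> it is midpoint
  convexity of the power with exponent \<open>1/k\<close>, applied to \<open>u\<^sup>k\<close> and \<open>v\<^sup>k\<close>.\<close>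
lemma powr_add_le_pert_c:
  fixes u v k :: real
  assumes "u \<ge> 0" "v \<ge> 0" "k > 0"
  shows "u powr k + v powr k \<le> pert_c k * (u + v) powr k"
proof (cases "u = 0 \<or> v = 0")
  case True
  have "pert_c k \<ge> 1" by (auto simp: pert_c_def ge_one_powr_ge_zero)
  moreover have "u powr k + v powr k = (u + v) powr k"
    using True \<open>k > 0\<close> by auto
  ultimately show ?thesis
    by (metis mult_le_cancel_right1 powr_ge_zero linorder_not_less)
next
  case False
  then have uv: "u > 0" "v > 0" using assms by auto
  show ?thesis
  proof (cases "k \<ge> 1")
    case True
    have part: "w powr k \<le> w / (u + v) * (u + v) powr k" if "0 < w" "w \<le> u + v" for w
    proof -
      have "(w / (u + v)) powr k \<le> (w / (u + v)) powr 1"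
        using that True by (intro powr_mono') auto
      then have "(w / (u + v)) powr k * (u + v) powr k \<le> w / (u + v) * (u + v) powr k"
        using that by (intro mult_right_mono) auto
      then show ?thesis using that by (simp add: powr_mult[symmetric])
    qed
    have "u powr k + v powr k \<le> u / (u + v) * (u + v) powr k + v / (u + v) * (u + v) powr k"
      using part[of u] part[of v] uv by (intro add_mono) auto
    also have "\<dots> = (u + v) powr k"
      using uv by (simp add: distrib_right[symmetric] add_divide_distrib[symmetric])
    finally show ?thesis using True by (simp add: pert_c_def)
  next
    case k: False
    let ?a = "u powr k" and ?b = "v powr k"
    have ab: "?a > 0" "?b > 0" using uv by auto
    have "((1 - 1/2) *\<^sub>R ?a + (1/2) *\<^sub>R ?b) powr (1/k)
        \<le> (1 - 1/2) * ?a powr (1/k) + 1/2 * ?b powr (1/k)"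
      using k \<open>k > 0\<close> ab by (intro convex_onD[OF powr_convex]) auto
    also have "\<dots> = (u + v) / 2" using uv \<open>k > 0\<close> by (simp add: powr_powr)
    finally have "((?a + ?b) / 2) powr (1/k) \<le> (u + v) / 2" by (simp add: add_divide_distrib)
    then have "(((?a + ?b) / 2) powr (1/k)) powr k \<le> ((u + v) / 2) powr k"
      using \<open>k > 0\<close> by (intro powr_mono2) auto
    then have "(?a + ?b) / 2 \<le> (u + v) powr k / 2 powr k"
      using \<open>k > 0\<close> ab uv by (simp add: powr_powr powr_divide)
    then show ?thesis
      using k by (simp add: pert_c_def powr_diff field_simps)
  qed
qed

lemma powr_inequality_linearized:
  fixes d s t k :: real
  assumes "0 \<le> d" "0 \<le> s" "0 \<le> t" "k > 0" "0 \<le> l\<^sub>1" "0 \<le> l\<^sub>2"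
    and "d powr k \<le> l\<^sub>1 * s powr k + l\<^sub>2 * t powr k"
  shows "d \<le> pert_c k powr (1/k) * l\<^sub>1 powr (1/k) * s + pert_c k powr (1/k) * l\<^sub>2 powr (1/k) * t"
proof -
  let ?u = "l\<^sub>1 powr (1/k) * s" and ?v = "l\<^sub>2 powr (1/k) * t"
  have c: "pert_c k > 0" by (simp add: pert_c_def)
  have "d powr k \<le> ?u powr k + ?v powr k"
    using assms by (simp add: powr_mult powr_powr)
  also have "\<dots> \<le> pert_c k * (?u + ?v) powr k"
    using assms by (intro powr_add_le_pert_c) auto
  also have "\<dots> = (pert_c k powr (1/k) * (?u + ?v)) powr k"
    using assms c by (simp add: powr_mult powr_powr)
  finally have "\<not> pert_c k powr (1/k) * (?u + ?v) < d"
    using powr_less_mono2[of k "pert_c k powr (1/k) * (?u + ?v)" d] assms by auto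
  then show ?thesis by (simp add: algebra_simps)
qed

text \<open>The bound on \<open>l\<close> is \<open>1\<close> for \<open>k \<ge> 1\<close> and \<open>2 powr (k - 1)\<close> for \<open>k \<le> 1\<close>, which is the
  reciprocal of \<open>pert_c k\<close> in both cases.\<close>
lemma pert_constant_less_1:
  assumes "k > 0" "0 \<le> l" "l < min 1 (2 powr (k - 1))"
  shows "pert_c k powr (1/k) * l powr (1/k) < 1"
proof -
  have c: "pert_c k > 0" by (simp add: pert_c_def)
  have "pert_c k * l < 1"
    using assms by (auto simp: pert_c_def powr_diff field_simps)
  then have "(pert_c k * l) powr (1/k) < 1 powr (1/k)"
    using assms c by (intro powr_less_mono2) auto
  then show ?thesis using assms c by (simp add: powr_mult)
qed

section \<open>Hilbert-Schmidt operators\<close>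

text \<open>Multiplying \<open>x\<close> by a phase makes \<open>cinner x y\<close> real, which reduces the claim to the real inner
  product.\<close>
lemma cinner_cauchy_schwarz: "cmod (cinner x y) \<le> norm x * norm y"
proof (cases "cinner x y = 0")
  case False
  define a where "a = cnj (cinner x y) / cmod (cinner x y)"
  have cmod_a: "cmod a = 1"
    using False by (simp add: a_def norm_divide)
  then have "cnj a * a = 1"
    using complex_norm_square[of a] by (simp add: mult.commute)
  then have "cinner (a *\<^sub>C x) (a *\<^sub>C x) = cinner x x"
    by (simp add: cinner_scaleC_left cinner_scaleC_right mult.assoc[symmetric])
  then have norm_ax: "norm (a *\<^sub>C x) = norm x"
    by (simp add: norm_eq_sqrt_inner inner_eq_Re_cinner)
  have "complex_of_real (cmod (cinner x y)) = cinner (a *\<^sub>C x) y"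
    using False complex_norm_square[of "cinner x y"]
    by (simp add: a_def cinner_scaleC_left field_simps power2_eq_square)
  then have "cmod (cinner x y) = inner (a *\<^sub>C x) y"
    by (metis Re_complex_of_real inner_eq_Re_cinner)
  also have "\<dots> \<le> norm x * norm y"
    using norm_cauchy_schwarz[of "a *\<^sub>C x" y] norm_ax by simp
  finally show ?thesis .
qed simp

lemma hs_inner_self:
  assumes "T \<in> hs_class E"
  shows "hs_inner E T T = of_real (\<Sum>\<^sub>\<infinity>e\<in>E. (norm (T e))\<^sup>2)"
  unfolding hs_inner_def cinner_self
  using assms by (intro infsumI has_sum_of_real has_sum_infsum) (simp add: hs_class_def)

lemma hs_norm_power2:
  assumes "T \<in> hs_class E"
  shows "(hs_norm E T)\<^sup>2 = (\<Sum>\<^sub>\<infinity>e\<in>E. (norm (T e))\<^sup>2)"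
  by (simp add: hs_norm_def hs_inner_self[OF assms] infsum_nonneg)

lemma hs_norm_nonneg: "T \<in> hs_class E \<Longrightarrow> 0 \<le> hs_norm E T"
  by (simp add: hs_norm_def hs_inner_self infsum_nonneg)

text \<open>This one estimate on finite subsets of \<open>E\<close> provides both the convergence of the series for
  \<open>hs_inner E T S\<close> and the Cauchy-Schwarz inequality for its value.\<close>
lemma sum_cmod_cinner_le_hs_norm:
  assumes "T \<in> hs_class E" "S \<in> hs_class E" "finite F" "F \<subseteq> E"
  shows "(\<Sum>e\<in>F. cmod (cinner (T e) (S e))) \<le> hs_norm E T * hs_norm E S"
proof -
  have L2: "L2_set (\<lambda>e. norm (R e)) F \<le> hs_norm E R" if "R \<in> hs_class E" for R
  proof -
    have "(\<Sum>e\<in>F. (norm (R e))\<^sup>2) \<le> (hs_norm E R)\<^sup>2"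
      unfolding hs_norm_power2[OF that]
      using that assms by (intro finite_sum_le_infsum) (auto simp: hs_class_def)
    then show ?thesis
      using hs_norm_nonneg[OF that] by (simp add: L2_set_def real_le_lsqrt)
  qed
  have "(\<Sum>e\<in>F. cmod (cinner (T e) (S e))) \<le> (\<Sum>e\<in>F. \<bar>norm (T e)\<bar> * \<bar>norm (S e)\<bar>)"
    by (intro sum_mono) (simp add: cinner_cauchy_schwarz)
  also have "\<dots> \<le> L2_set (\<lambda>e. norm (T e)) F * L2_set (\<lambda>e. norm (S e)) F"
    by (rule L2_set_mult_ineq)
  also have "\<dots> \<le> hs_norm E T * hs_norm E S"
    using assms L2 by (intro mult_mono) (auto simp: hs_norm_nonneg)
  finally show ?thesis .
qed

lemma cinner_abs_summable_on_hs_class: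
  assumes "T \<in> hs_class E" "S \<in> hs_class E"
  shows "(\<lambda>e. cmod (cinner (T e) (S e))) summable_on E"
  using sum_cmod_cinner_le_hs_norm[OF assms]
  by (intro nonneg_bdd_above_summable_on) (auto simp: bdd_above_def)

lemma cinner_summable_on_hs_class:
  assumes "T \<in> hs_class E" "S \<in> hs_class E"
  shows "(\<lambda>e. cinner (T e) (S e)) summable_on E"
  using cinner_abs_summable_on_hs_class[OF assms] by (rule abs_summable_summable)

lemma hs_cauchy_schwarz:
  assumes "T \<in> hs_class E" "S \<in> hs_class E"
  shows "cmod (hs_inner E T S) \<le> hs_norm E T * hs_norm E S"
proof -
  have "cmod (hs_inner E T S) \<le> (\<Sum>\<^sub>\<infinity>e\<in>E. cmod (cinner (T e) (S e)))"
    unfolding hs_inner_def by (rule norm_infsum_bound[OF cinner_abs_summable_on_hs_class[OF assms]])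
  also have "\<dots> \<le> hs_norm E T * hs_norm E S"
    using sum_cmod_cinner_le_hs_norm[OF assms]
    by (intro infsum_le_finite_sums cinner_abs_summable_on_hs_class assms)
  finally show ?thesis .
qed

lemma scaleR_scaleC_commute: "r *\<^sub>R (a *\<^sub>C x) = a *\<^sub>C (r *\<^sub>R x)"
  by (simp add: scaleC_of_real[symmetric] scaleC_scaleC mult.commute)

text \<open>The image of the unit ball lies in a sum of two compact sets, which is compact.\<close>
lemma compact_operator_lincomb:
  fixes r s :: real
  assumes "compact_operator T" "compact_operator S"
  shows "compact_operator (\<lambda>u. r *\<^sub>R T u + s *\<^sub>R S u)"
proof -
  have lin: "Vector_Spaces.linear scaleC scaleC T" "Vector_Spaces.linear scaleC scaleC S"
    using assms by (auto simp: compact_operator_def)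
  interpret T: Vector_Spaces.linear scaleC scaleC T by (fact lin)
  interpret S: Vector_Spaces.linear scaleC scaleC S by (fact lin)
  have "Vector_Spaces.linear scaleC scaleC (\<lambda>u. r *\<^sub>R T u + s *\<^sub>R S u)"
    by unfold_locales
       (auto simp: T.add S.add T.scale S.scale scaleC_add_right scaleR_add_right
         scaleR_scaleC_commute)
  moreover have "compact (closure ((\<lambda>u. r *\<^sub>R T u + s *\<^sub>R S u) ` ball 0 1))"
  proof -
    define K where "K = {x + y |x y. x \<in> (*\<^sub>R) r ` closure (T ` ball 0 1)
                                  \<and> y \<in> (*\<^sub>R) s ` closure (S ` ball 0 1)}"
    have "compact K"
      unfolding K_def using assms
      by (intro compact_sums compact_scaling) (auto simp: compact_operator_def)
    moreover have "(\<lambda>u. r *\<^sub>R T u + s *\<^sub>R S u) ` ball 0 1 \<subseteq> K"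
      unfolding K_def using closure_subset by blast
    ultimately show ?thesis
      by (metis closure_minimal compact_Int_closed compact_imp_closed closed_closure inf.absorb_iff2)
  qed
  ultimately show ?thesis by (simp add: compact_operator_def)
qed

text \<open>The difference of the two sides is \<open>r * s * (norm (a - b))\<^sup>2\<close>.\<close>
lemma norm_convex_power2:
  fixes a b :: "'a::real_inner"
  assumes "0 \<le> r" "0 \<le> s" "r + s = 1"
  shows "(norm (r *\<^sub>R a + s *\<^sub>R b))\<^sup>2 \<le> r * (norm a)\<^sup>2 + s * (norm b)\<^sup>2"
proof -
  have r: "r = 1 - s" using assms by simp
  have "r * (norm a)\<^sup>2 + s * (norm b)\<^sup>2 - (norm (r *\<^sub>R a + s *\<^sub>R b))\<^sup>2 = r * s * (norm (a - b))\<^sup>2"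
    unfolding power2_norm_eq_inner r by (simp add: inner_commute algebra_simps)
  moreover have "0 \<le> r * s * (norm (a - b))\<^sup>2" using assms by simp
  ultimately show ?thesis by linarith
qed

lemma hs_class_lincomb:
  fixes r s :: real
  assumes "T \<in> hs_class E" "S \<in> hs_class E"
  shows "(\<lambda>u. r *\<^sub>R T u + s *\<^sub>R S u) \<in> hs_class E"
proof -
  have "(\<lambda>e. 2 * r\<^sup>2 * (norm (T e))\<^sup>2 + 2 * s\<^sup>2 * (norm (S e))\<^sup>2) summable_on E"
    using assms by (intro summable_on_add summable_on_cmult_right) (auto simp: hs_class_def)
  then have "(\<lambda>e. (norm (r *\<^sub>R T e + s *\<^sub>R S e))\<^sup>2) summable_on E"
  proof (rule summable_on_comparison_test)
    fix e
    \<comment> \<open>Writing the sum as twice a midpoint reduces the bound to convexity.\<close>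
    have "(norm (r *\<^sub>R T e + s *\<^sub>R S e))\<^sup>2 = 4 * (norm ((1/2) *\<^sub>R (r *\<^sub>R T e) + (1/2) *\<^sub>R (s *\<^sub>R S e)))\<^sup>2"
      by (simp only: scaleR_add_right[symmetric] norm_scaleR power_mult_distrib)
         (simp add: power2_eq_square)
    also have "\<dots> \<le> 2 * r\<^sup>2 * (norm (T e))\<^sup>2 + 2 * s\<^sup>2 * (norm (S e))\<^sup>2"
      using norm_convex_power2[of "1/2" "1/2" "r *\<^sub>R T e" "s *\<^sub>R S e"]
      by (simp add: power_mult_distrib)
    finally show "(norm (r *\<^sub>R T e + s *\<^sub>R S e))\<^sup>2 \<le> \<dots>" .
  qed simp
  then show ?thesis
    using assms by (simp add: hs_class_def compact_operator_lincomb)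
qed

text \<open>Convexity of the squared norm can be summed termwise over \<open>E\<close>, and later over an index set; it
  is the form in which the unit ball of families is seen to be convex.\<close>
lemma hs_norm_convex_power2:
  assumes "T \<in> hs_class E" "S \<in> hs_class E" "0 \<le> r" "0 \<le> s" "r + s = 1"
  shows "(hs_norm E (\<lambda>u. r *\<^sub>R T u + s *\<^sub>R S u))\<^sup>2 \<le> r * (hs_norm E T)\<^sup>2 + s * (hs_norm E S)\<^sup>2"
proof -
  have sum: "(\<lambda>e. (norm (T e))\<^sup>2) summable_on E" "(\<lambda>e. (norm (S e))\<^sup>2) summable_on E"
    using assms by (auto simp: hs_class_def)
  note lc = hs_class_lincomb[OF assms(1,2), of r s]
  have "(hs_norm E (\<lambda>u. r *\<^sub>R T u + s *\<^sub>R S u))\<^sup>2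
      \<le> (\<Sum>\<^sub>\<infinity>e\<in>E. r * (norm (T e))\<^sup>2 + s * (norm (S e))\<^sup>2)"
    unfolding hs_norm_power2[OF lc]
    using lc assms sum
    by (intro infsum_mono norm_convex_power2 summable_on_add summable_on_cmult_right)
       (auto simp: hs_class_def)
  also have "\<dots> = r * (hs_norm E T)\<^sup>2 + s * (hs_norm E S)\<^sup>2"
    using sum by (simp add: hs_norm_power2 assms infsum_add summable_on_cmult_right infsum_cmult_right)
  finally show ?thesis .
qed

lemma hs_inner_lincomb_right:
  fixes r s :: real
  assumes "X \<in> hs_class E" "T \<in> hs_class E" "S \<in> hs_class E"
  shows "hs_inner E X (\<lambda>u. r *\<^sub>R T u + s *\<^sub>R S u) = of_real r * hs_inner E X T + of_real s * hs_inner E X S"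
proof -
  have "(\<lambda>e. cinner (X e) (r *\<^sub>R T e + s *\<^sub>R S e))
      = (\<lambda>e. of_real r * cinner (X e) (T e) + of_real s * cinner (X e) (S e))"
    by (simp add: cinner_add_right cinner_scaleR_right)
  then show ?thesis
    using assms by (simp add: hs_inner_def infsum_add summable_on_cmult_right
        cinner_summable_on_hs_class infsum_cmult_right)
qed

lemma hs_inner_add_left:
  assumes "X \<in> hs_class E" "Y \<in> hs_class E" "T \<in> hs_class E"
  shows "hs_inner E (\<lambda>u. X u + Y u) T = hs_inner E X T + hs_inner E Y T"
  using assms by (simp add: hs_inner_def cinner_add_left infsum_add cinner_summable_on_hs_class)

lemma hs_inner_scaleC_left: "hs_inner E (\<lambda>u. a *\<^sub>C X u) T = a * hs_inner E X T"
  by (simp add: hs_inner_def cinner_scaleC_left infsum_cmult_right')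

lemma cinner_eqI:
  assumes "\<And>x. cinner x y = cinner x z"
  shows "y = z"
proof -
  have "inner x y = inner x z" for x
    by (simp add: inner_eq_Re_cinner assms)
  then have "inner x (y - z) = 0" for x
    by (simp add: inner_diff_right)
  then have "inner (y - z) (y - z) = 0" .
  then show ?thesis by simp
qed

lemma hs_adjoint_eqI:
  assumes "\<And>x. hs_inner E (G x) T = cinner x y"
  shows "hs_adjoint E G T = y"
  unfolding hs_adjoint_def
proof (rule the_equality)
  show "z = y" if "\<forall>x. hs_inner E (G x) T = cinner x z" for z
    using that assms by (intro cinner_eqI) simp
qed (simp add: assms)

text \<open>\<open>x \<mapsto> hs_inner E (G x) T\<close> is a bounded functional by the Cauchy-Schwarz inequality, so the vector
  that defines \<open>hs_adjoint\<close> exists by the Riesz representation theorem.\<close>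
lemma hs_inner_hs_adjoint:
  fixes G :: "'h::complex_hilbert \<Rightarrow> 'k::complex_inner \<Rightarrow> 'k"
  assumes G: "hs_bounded_linear E G" and T: "T \<in> hs_class E"
  shows "hs_inner E (G x) T = cinner x (hs_adjoint E G T)"
proof -
  have G_hs: "G z \<in> hs_class E" for z
    using G by (simp add: hs_bounded_linear_def)
  obtain M where M: "\<And>z. hs_norm E (G z) \<le> M * norm z"
    using G by (auto simp: hs_bounded_linear_def)
  obtain y where "\<And>z. hs_inner E (G z) T = cinner z y"
  proof (rule riesz_complex)
    show "hs_inner E (G (z + w)) T = hs_inner E (G z) T + hs_inner E (G w) T" for z w
      using G hs_inner_add_left[OF G_hs G_hs T] by (simp add: hs_bounded_linear_def)
    show "hs_inner E (G (a *\<^sub>C z)) T = a * hs_inner E (G z) T" for a z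
      using G hs_inner_scaleC_left by (simp add: hs_bounded_linear_def)
    show "\<bar>Re (hs_inner E (G z) T)\<bar> \<le> (M * hs_norm E T) * norm z" for z
    proof -
      have "\<bar>Re (hs_inner E (G z) T)\<bar> \<le> hs_norm E (G z) * hs_norm E T"
        using abs_Re_le_cmod hs_cauchy_schwarz[OF G_hs T] order_trans by blast
      also have "\<dots> \<le> (M * norm z) * hs_norm E T"
        by (intro mult_right_mono M hs_norm_nonneg T)
      finally show ?thesis by (simp add: mult_ac)
    qed
  qed blast
  then show ?thesis using hs_adjoint_eqI[of E G T y] by simp
qed

lemma hs_adjoint_lincomb:
  fixes G :: "'h::complex_hilbert \<Rightarrow> 'k::complex_inner \<Rightarrow> 'k" and r s :: real
  assumes G: "hs_bounded_linear E G" and "T \<in> hs_class E" "S \<in> hs_class E"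
  shows "hs_adjoint E G (\<lambda>u. r *\<^sub>R T u + s *\<^sub>R S u) = r *\<^sub>R hs_adjoint E G T + s *\<^sub>R hs_adjoint E G S"
proof (rule hs_adjoint_eqI)
  fix x
  have "G x \<in> hs_class E" using G by (simp add: hs_bounded_linear_def)
  then show "hs_inner E (G x) (\<lambda>u. r *\<^sub>R T u + s *\<^sub>R S u)
      = cinner x (r *\<^sub>R hs_adjoint E G T + s *\<^sub>R hs_adjoint E G S)"
    using assms by (simp add: hs_inner_lincomb_right hs_inner_hs_adjoint cinner_add_right
        cinner_scaleR_right)
qed

section \<open>Synthesis of finite families\<close>

text \<open>The finitely supported families in \<open>\<ell>\<^sup>2(I, \<C>\<^sub>2)\<close>. The index set \<open>J\<close> is explicit, and the values
  of \<open>T\<close> outside \<open>J\<close> are arbitrary.\<close>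
definition hs_family :: "'k::complex_inner set \<Rightarrow> 'i set \<Rightarrow> 'i set \<Rightarrow> ('i \<Rightarrow> 'k \<Rightarrow> 'k) \<Rightarrow> bool" where
  "hs_family E I J T \<longleftrightarrow> finite J \<and> J \<subseteq> I \<and> (\<forall>i\<in>J. T i \<in> hs_class E)"

definition synthesis :: "'k::complex_inner set \<Rightarrow> ('i \<Rightarrow> 'h::complex_hilbert \<Rightarrow> 'k \<Rightarrow> 'k)
    \<Rightarrow> 'i set \<Rightarrow> ('i \<Rightarrow> 'k \<Rightarrow> 'k) \<Rightarrow> 'h" where
  "synthesis E G J T = (\<Sum>i\<in>J. hs_adjoint E (G i) (T i))"

definition unit_synthesis :: "'k::complex_inner set \<Rightarrow> 'i set
    \<Rightarrow> ('i \<Rightarrow> 'h::complex_hilbert \<Rightarrow> 'k \<Rightarrow> 'k) \<Rightarrow> 'h set" where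
  "unit_synthesis E I G =
     {synthesis E G J T |J T. hs_family E I J T \<and> (\<Sum>i\<in>J. (hs_norm E (T i))\<^sup>2) \<le> 1}"

text \<open>Extension by zero, which brings two families to a common index set before they are combined.\<close>
definition pad :: "'i set \<Rightarrow> ('i \<Rightarrow> 'k \<Rightarrow> 'k::zero) \<Rightarrow> 'i \<Rightarrow> 'k \<Rightarrow> 'k" where
  "pad J T i = (if i \<in> J then T i else (\<lambda>_. 0))"

lemma zero_in_hs_class: "(\<lambda>_. 0) \<in> hs_class E"
proof -
  have "Vector_Spaces.linear scaleC scaleC (\<lambda>_::'a. 0::'a)"
    by unfold_locales (auto simp: cvec.scale_zero_right)
  moreover have "(\<lambda>_::'a. 0::'a) ` ball 0 1 = {0}"
    by (auto simp: image_constant_conv)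
  ultimately show ?thesis by (simp add: hs_class_def compact_operator_def)
qed

lemma hs_family_pad:
  assumes "hs_family E I J T" "finite J'" "J' \<subseteq> I"
  shows "hs_family E I J' (pad J T)"
  using assms by (auto simp: hs_family_def pad_def zero_in_hs_class)

lemma synthesis_pad:
  assumes "finite J'" "J \<subseteq> J'"
  shows "synthesis E G J' (pad J T) = synthesis E G J T"
proof -
  have "hs_adjoint E (G i) (\<lambda>_. 0) = 0" for i
    by (rule hs_adjoint_eqI) (simp add: hs_inner_def cinner_zero_right)
  then show ?thesis
    unfolding synthesis_def using assms by (intro sum.mono_neutral_cong_right) (auto simp: pad_def)
qed

lemma sum_hs_norm_pad:
  fixes E :: "'k::complex_inner set"
  assumes "finite J'" "J \<subseteq> J'"
  shows "(\<Sum>i\<in>J'. (hs_norm E (pad J T i))\<^sup>2) = (\<Sum>i\<in>J. (hs_norm E (T i))\<^sup>2)"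
proof -
  have "hs_norm E (\<lambda>_. 0) = 0"
    using hs_norm_power2[OF zero_in_hs_class[of E]] by simp
  then show ?thesis
    using assms by (intro sum.mono_neutral_cong_right) (auto simp: pad_def)
qed

lemma hs_family_lincomb:
  fixes r s :: real
  assumes "hs_family E I J T" "hs_family E I J S"
  shows "hs_family E I J (\<lambda>i u. r *\<^sub>R T i u + s *\<^sub>R S i u)"
  using assms by (auto simp: hs_family_def hs_class_lincomb)

lemma synthesis_lincomb:
  fixes r s :: real
  assumes "\<forall>i\<in>I. hs_bounded_linear E (G i)"
    and "hs_family E I J T" "hs_family E I J S"
  shows "synthesis E G J (\<lambda>i u. r *\<^sub>R T i u + s *\<^sub>R S i u)
       = r *\<^sub>R synthesis E G J T + s *\<^sub>R synthesis E G J S"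
proof -
  have "hs_adjoint E (G i) (\<lambda>u. r *\<^sub>R T i u + s *\<^sub>R S i u)
      = r *\<^sub>R hs_adjoint E (G i) (T i) + s *\<^sub>R hs_adjoint E (G i) (S i)" if "i \<in> J" for i
    using assms that by (intro hs_adjoint_lincomb) (auto simp: hs_family_def)
  then show ?thesis by (simp add: synthesis_def sum.distrib scaleR_sum_right)
qed

text \<open>The combined family is the same for every \<open>G\<close>. It serves two purposes: with arbitrary scalars it
  shows that the pairs of synthesised vectors form a subspace, and with convex weights that the
  image of the unit ball is convex.\<close>
lemma hs_family_lincomb_exists:
  fixes E :: "'k::complex_inner set" and r s :: real
  assumes 1: "hs_family E I J\<^sub>1 T\<^sub>1" and 2: "hs_family E I J\<^sub>2 T\<^sub>2"
  obtains J T where "hs_family E I J T"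
    and "\<forall>G :: 'i \<Rightarrow> 'h::complex_hilbert \<Rightarrow> 'k \<Rightarrow> 'k. (\<forall>i\<in>I. hs_bounded_linear E (G i)) \<longrightarrow>
      synthesis E G J T = r *\<^sub>R synthesis E G J\<^sub>1 T\<^sub>1 + s *\<^sub>R synthesis E G J\<^sub>2 T\<^sub>2"
    and "0 \<le> r \<Longrightarrow> 0 \<le> s \<Longrightarrow> r + s = 1 \<Longrightarrow> (\<Sum>i\<in>J. (hs_norm E (T i))\<^sup>2)
      \<le> r * (\<Sum>i\<in>J\<^sub>1. (hs_norm E (T\<^sub>1 i))\<^sup>2) + s * (\<Sum>i\<in>J\<^sub>2. (hs_norm E (T\<^sub>2 i))\<^sup>2)"
proof -
  define J S\<^sub>1 S\<^sub>2 where "J = J\<^sub>1 \<union> J\<^sub>2" and "S\<^sub>1 = pad J\<^sub>1 T\<^sub>1" and "S\<^sub>2 = pad J\<^sub>2 T\<^sub>2"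
  have J: "finite J" "J \<subseteq> I" "J\<^sub>1 \<subseteq> J" "J\<^sub>2 \<subseteq> J"
    using 1 2 by (auto simp: J_def hs_family_def)
  have fam: "hs_family E I J S\<^sub>1" "hs_family E I J S\<^sub>2"
    unfolding S\<^sub>1_def S\<^sub>2_def using 1 2 J by (auto intro: hs_family_pad)
  define T where "T = (\<lambda>i u. r *\<^sub>R S\<^sub>1 i u + s *\<^sub>R S\<^sub>2 i u)"
  show thesis
  proof (rule that)
    show "hs_family E I J T"
      unfolding T_def by (rule hs_family_lincomb[OF fam])
    show "\<forall>G :: 'i \<Rightarrow> 'h \<Rightarrow> 'k \<Rightarrow> 'k. (\<forall>i\<in>I. hs_bounded_linear E (G i)) \<longrightarrow>
        synthesis E G J T = r *\<^sub>R synthesis E G J\<^sub>1 T\<^sub>1 + s *\<^sub>R synthesis E G J\<^sub>2 T\<^sub>2"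
    proof (intro allI impI)
      fix G :: "'i \<Rightarrow> 'h \<Rightarrow> 'k \<Rightarrow> 'k" assume G: "\<forall>i\<in>I. hs_bounded_linear E (G i)"
      show "synthesis E G J T = r *\<^sub>R synthesis E G J\<^sub>1 T\<^sub>1 + s *\<^sub>R synthesis E G J\<^sub>2 T\<^sub>2"
        unfolding T_def synthesis_lincomb[OF G fam]
        using J by (simp add: S\<^sub>1_def S\<^sub>2_def synthesis_pad)
    qed
    assume rs: "0 \<le> r" "0 \<le> s" "r + s = 1"
    have "(\<Sum>i\<in>J. (hs_norm E (T i))\<^sup>2)
        \<le> (\<Sum>i\<in>J. r * (hs_norm E (S\<^sub>1 i))\<^sup>2 + s * (hs_norm E (S\<^sub>2 i))\<^sup>2)"
      unfolding T_def using fam rs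
      by (intro sum_mono hs_norm_convex_power2) (auto simp: hs_family_def)
    also have "\<dots> = r * (\<Sum>i\<in>J\<^sub>1. (hs_norm E (T\<^sub>1 i))\<^sup>2) + s * (\<Sum>i\<in>J\<^sub>2. (hs_norm E (T\<^sub>2 i))\<^sup>2)"
      using J by (simp add: sum.distrib sum_distrib_left[symmetric] S\<^sub>1_def S\<^sub>2_def sum_hs_norm_pad)
    finally show "(\<Sum>i\<in>J. (hs_norm E (T i))\<^sup>2)
        \<le> r * (\<Sum>i\<in>J\<^sub>1. (hs_norm E (T\<^sub>1 i))\<^sup>2) + s * (\<Sum>i\<in>J\<^sub>2. (hs_norm E (T\<^sub>2 i))\<^sup>2)" .
  qed
qed

lemma convex_unit_synthesis:
  fixes G :: "'i \<Rightarrow> 'h::complex_hilbert \<Rightarrow> 'k::complex_inner \<Rightarrow> 'k"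
  assumes G: "\<forall>i\<in>I. hs_bounded_linear E (G i)"
  shows "convex (unit_synthesis E I G)"
proof (rule convexI)
  fix a b :: 'h and r s :: real
  assume a: "a \<in> unit_synthesis E I G" and b: "b \<in> unit_synthesis E I G"
    and rs: "0 \<le> r" "0 \<le> s" "r + s = 1"
  obtain J\<^sub>1 T\<^sub>1 where 1: "a = synthesis E G J\<^sub>1 T\<^sub>1" "hs_family E I J\<^sub>1 T\<^sub>1"
      "(\<Sum>i\<in>J\<^sub>1. (hs_norm E (T\<^sub>1 i))\<^sup>2) \<le> 1"
    using a by (auto simp: unit_synthesis_def)
  obtain J\<^sub>2 T\<^sub>2 where 2: "b = synthesis E G J\<^sub>2 T\<^sub>2" "hs_family E I J\<^sub>2 T\<^sub>2"
      "(\<Sum>i\<in>J\<^sub>2. (hs_norm E (T\<^sub>2 i))\<^sup>2) \<le> 1"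
    using b by (auto simp: unit_synthesis_def)
  show "r *\<^sub>R a + s *\<^sub>R b \<in> unit_synthesis E I G"
  proof (rule hs_family_lincomb_exists[OF 1(2) 2(2), of r s])
    fix J T
    assume fam: "hs_family E I J T"
      and syn: "\<forall>G :: 'i \<Rightarrow> 'h \<Rightarrow> 'k \<Rightarrow> 'k. (\<forall>i\<in>I. hs_bounded_linear E (G i)) \<longrightarrow>
        synthesis E G J T = r *\<^sub>R synthesis E G J\<^sub>1 T\<^sub>1 + s *\<^sub>R synthesis E G J\<^sub>2 T\<^sub>2"
      and le: "0 \<le> r \<Longrightarrow> 0 \<le> s \<Longrightarrow> r + s = 1 \<Longrightarrow> (\<Sum>i\<in>J. (hs_norm E (T i))\<^sup>2)
        \<le> r * (\<Sum>i\<in>J\<^sub>1. (hs_norm E (T\<^sub>1 i))\<^sup>2) + s * (\<Sum>i\<in>J\<^sub>2. (hs_norm E (T\<^sub>2 i))\<^sup>2)"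
    have "(\<Sum>i\<in>J. (hs_norm E (T i))\<^sup>2) \<le> r * 1 + s * 1"
      by (rule order_trans[OF le[OF rs]]) (intro add_mono mult_left_mono 1 2 rs)
    then have "(\<Sum>i\<in>J. (hs_norm E (T i))\<^sup>2) \<le> 1"
      using rs by simp
    moreover have "r *\<^sub>R a + s *\<^sub>R b = synthesis E G J T"
      using syn G by (simp add: 1 2)
    ultimately show ?thesis
      using fam unfolding unit_synthesis_def by blast
  qed
qed

lemma inner_synthesis:
  assumes "\<forall>i\<in>I. hs_bounded_linear E (G i)" and "hs_family E I J T"
  shows "inner x (synthesis E G J T) = (\<Sum>i\<in>J. Re (hs_inner E (G i x) (T i)))"
proof -
  have "hs_inner E (G i x) (T i) = cinner x (hs_adjoint E (G i) (T i))" if "i \<in> J" for i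
    using assms that by (intro hs_inner_hs_adjoint) (auto simp: hs_family_def)
  then have "inner x (hs_adjoint E (G i) (T i)) = Re (hs_inner E (G i x) (T i))" if "i \<in> J" for i
    using that by (simp add: inner_eq_Re_cinner)
  then show ?thesis by (simp add: synthesis_def inner_sum_right)
qed

definition synthesis_pairs :: "'k::complex_inner set \<Rightarrow> 'i set
    \<Rightarrow> ('i \<Rightarrow> 'h::complex_hilbert \<Rightarrow> 'k \<Rightarrow> 'k) \<Rightarrow> ('i \<Rightarrow> 'h \<Rightarrow> 'k \<Rightarrow> 'k) \<Rightarrow> ('h \<times> 'h) set" where
  "synthesis_pairs E I G H = {(synthesis E G J T, synthesis E H J T) |J T. hs_family E I J T}"

lemma subspace_synthesis_pairs:
  fixes G H :: "'i \<Rightarrow> 'h::complex_hilbert \<Rightarrow> 'k::complex_inner \<Rightarrow> 'k"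
  assumes G: "\<forall>i\<in>I. hs_bounded_linear E (G i)" and H: "\<forall>i\<in>I. hs_bounded_linear E (H i)"
  shows "subspace (synthesis_pairs E I G H)"
proof -
  have lincomb: "r *\<^sub>R p + s *\<^sub>R q \<in> synthesis_pairs E I G H"
    if p: "p \<in> synthesis_pairs E I G H" and q: "q \<in> synthesis_pairs E I G H" for p q and r s :: real
  proof -
    obtain J\<^sub>1 T\<^sub>1 where 1: "p = (synthesis E G J\<^sub>1 T\<^sub>1, synthesis E H J\<^sub>1 T\<^sub>1)" "hs_family E I J\<^sub>1 T\<^sub>1"
      using p by (auto simp: synthesis_pairs_def)
    obtain J\<^sub>2 T\<^sub>2 where 2: "q = (synthesis E G J\<^sub>2 T\<^sub>2, synthesis E H J\<^sub>2 T\<^sub>2)" "hs_family E I J\<^sub>2 T\<^sub>2"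
      using q by (auto simp: synthesis_pairs_def)
    show ?thesis
    proof (rule hs_family_lincomb_exists[OF 1(2) 2(2), of r s])
      fix J T
      assume "hs_family E I J T"
        and syn: "\<forall>G :: 'i \<Rightarrow> 'h \<Rightarrow> 'k \<Rightarrow> 'k. (\<forall>i\<in>I. hs_bounded_linear E (G i)) \<longrightarrow>
          synthesis E G J T = r *\<^sub>R synthesis E G J\<^sub>1 T\<^sub>1 + s *\<^sub>R synthesis E G J\<^sub>2 T\<^sub>2"
      moreover have "r *\<^sub>R p + s *\<^sub>R q = (synthesis E G J T, synthesis E H J T)"
        using syn G H by (simp add: 1 2)
      ultimately show ?thesis by (auto simp: synthesis_pairs_def)
    qed
  qed
  have "0 \<in> synthesis_pairs E I G H"
    by (force simp: synthesis_pairs_def synthesis_def hs_family_def zero_prod_def)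
  then show ?thesis
    using lincomb[of _ _ 1 1] lincomb[of _ _ _ 0] by (simp add: subspace_def)
qed

section \<open>Frames in terms of the synthesised unit ball\<close>

text \<open>Together with the next lemma this computes the support function of \<open>unit_synthesis E I G\<close> at
  \<open>x\<close>: it is the supremum over finite \<open>J\<close> of the right-hand side. The upper estimate is the
  Cauchy-Schwarz inequality for families.\<close>
lemma inner_unit_synthesis_le:
  assumes G: "\<forall>i\<in>I. hs_bounded_linear E (G i)" and "d \<in> unit_synthesis E I G"
  obtains J where "finite J" "J \<subseteq> I" "\<forall>x. inner x d \<le> sqrt (\<Sum>i\<in>J. (hs_norm E (G i x))\<^sup>2)"
proof -
  obtain J T where d: "d = synthesis E G J T" and fam: "hs_family E I J T"
      and T: "(\<Sum>i\<in>J. (hs_norm E (T i))\<^sup>2) \<le> 1"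
    using assms(2) by (auto simp: unit_synthesis_def)
  show thesis
  proof (rule that)
    show "finite J" "J \<subseteq> I" using fam by (auto simp: hs_family_def)
    show "\<forall>x. inner x d \<le> sqrt (\<Sum>i\<in>J. (hs_norm E (G i x))\<^sup>2)"
    proof
      fix x
      have "Re (hs_inner E (G i x) (T i)) \<le> \<bar>hs_norm E (G i x)\<bar> * \<bar>hs_norm E (T i)\<bar>" if "i \<in> J" for i
      proof -
        have "G i x \<in> hs_class E" "T i \<in> hs_class E"
          using fam G that by (auto simp: hs_family_def hs_bounded_linear_def)
        then show ?thesis
          using hs_cauchy_schwarz complex_Re_le_cmod order_trans by (fastforce simp: hs_norm_nonneg)
      qed
      then have "inner x d \<le> (\<Sum>i\<in>J. \<bar>hs_norm E (G i x)\<bar> * \<bar>hs_norm E (T i)\<bar>)"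
        unfolding d by (subst inner_synthesis[OF G fam]) (auto intro: sum_mono)
      also have "\<dots> \<le> L2_set (\<lambda>i. hs_norm E (G i x)) J * L2_set (\<lambda>i. hs_norm E (T i)) J"
        by (rule L2_set_mult_ineq)
      also have "\<dots> \<le> L2_set (\<lambda>i. hs_norm E (G i x)) J * 1"
        using T by (intro mult_left_mono) (auto simp: L2_set_def sum_nonneg)
      finally show "inner x d \<le> sqrt (\<Sum>i\<in>J. (hs_norm E (G i x))\<^sup>2)"
        by (simp add: L2_set_def)
    qed
  qed
qed

text \<open>Equality in the Cauchy-Schwarz inequality is attained by the normalisation of the family
  \<open>\<lambda>i. G i x\<close>.\<close>
lemma unit_synthesis_norming:
  fixes G :: "'i \<Rightarrow> 'h::complex_hilbert \<Rightarrow> 'k::complex_inner \<Rightarrow> 'k"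
  assumes G: "\<forall>i\<in>I. hs_bounded_linear E (G i)" and J: "finite J" "J \<subseteq> I"
  obtains d where "d \<in> unit_synthesis E I G"
    and "inner x d = sqrt (\<Sum>i\<in>J. (hs_norm E (G i x))\<^sup>2)"
proof -
  define q where "q = sqrt (\<Sum>i\<in>J. (hs_norm E (G i x))\<^sup>2)"
  have q2: "q\<^sup>2 = (\<Sum>i\<in>J. (hs_norm E (G i x))\<^sup>2)" by (simp add: q_def sum_nonneg)
  have hs: "G i z \<in> hs_class E" if "i \<in> J" for i z
    using G J that by (auto simp: hs_bounded_linear_def)
  \<comment> \<open>If \<open>q = 0\<close>, then \<open>1/q = 0\<close> and the family vanishes, which is still the right choice.\<close>
  define T where "T i = G i ((1/q) *\<^sub>R x)" for i
  have T: "T i = (\<lambda>u. complex_of_real (1/q) *\<^sub>C G i x u)" if "i \<in> J" for i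
    using G J that unfolding T_def scaleC_of_real[symmetric] hs_bounded_linear_def by blast
  have fam: "hs_family E I J T"
    using J hs by (auto simp: hs_family_def T_def)
  have inner_T: "hs_inner E X (T i) = of_real (1/q) * hs_inner E X (G i x)" if "i \<in> J" for i X
    unfolding T[OF that] hs_inner_def
    by (simp only: cinner_scaleC_right infsum_cmult_right' complex_cnj_complex_of_real)
  have self: "Re (hs_inner E (G i x) (G i x)) = (hs_norm E (G i x))\<^sup>2" if "i \<in> J" for i
    using hs[OF that, of x] by (simp add: hs_norm_power2 hs_inner_self)
  have norm_T: "(hs_norm E (T i))\<^sup>2 = (1/q)\<^sup>2 * (hs_norm E (G i x))\<^sup>2" if "i \<in> J" for i
  proof -
    have "hs_inner E (T i) (T i) = of_real ((1/q)\<^sup>2) * hs_inner E (G i x) (G i x)"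
      unfolding inner_T[OF that] unfolding T[OF that]
      by (simp add: hs_inner_scaleC_left power2_eq_square)
    moreover have "Re (hs_inner E (T i) (T i)) = (hs_norm E (T i))\<^sup>2"
      using hs[OF that] by (simp add: T_def hs_norm_power2 hs_inner_self)
    ultimately show ?thesis using self[OF that] by (simp add: Re_divide_of_real)
  qed
  show thesis
  proof (rule that)
    have "(\<Sum>i\<in>J. (hs_norm E (T i))\<^sup>2) = (1/q)\<^sup>2 * q\<^sup>2"
      unfolding q2 sum_distrib_left by (intro sum.cong refl norm_T)
    also have "\<dots> \<le> 1" by (simp add: power_divide)
    finally show "synthesis E G J T \<in> unit_synthesis E I G"
      using fam by (auto simp: unit_synthesis_def)
    have "inner x (synthesis E G J T) = (\<Sum>i\<in>J. (1/q) * (hs_norm E (G i x))\<^sup>2)"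
      by (subst inner_synthesis[OF G fam])
         (auto simp: inner_T self[symmetric] Re_divide_of_real intro!: sum.cong)
    also have "\<dots> = (1/q) * q\<^sup>2" by (simp add: q2 sum_distrib_left)
    also have "\<dots> = q" by (simp add: power2_eq_square)
    finally show "inner x (synthesis E G J T) = sqrt (\<Sum>i\<in>J. (hs_norm E (G i x))\<^sup>2)"
      by (simp add: q_def)
  qed
qed

text \<open>Duality between a convex set and its support function. If \<open>y\<close> is separated from \<open>closure D\<close>
  by \<open>w\<close>, then the support function at \<open>w\<close>, which is at least \<open>\<alpha> * norm w\<close> by the lower frame
  bound, is less than \<open>inner w y\<close>, so that \<open>norm y > \<alpha>\<close>. The other implications evaluate the
  support function directly.\<close>
lemma hs_frame_iff_unit_synthesis:
  fixes G :: "'i \<Rightarrow> 'h::complex_hilbert \<Rightarrow> 'k::complex_inner \<Rightarrow> 'k"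
  assumes G: "\<forall>i\<in>I. hs_bounded_linear E (G i)" and \<alpha>: "\<alpha> > 0" and \<beta>: "\<beta> > 0"
  shows "hs_frame E I G (\<alpha>\<^sup>2) (\<beta>\<^sup>2) \<longleftrightarrow>
    ball 0 \<alpha> \<subseteq> closure (unit_synthesis E I G) \<and> unit_synthesis E I G \<subseteq> cball 0 \<beta>"
    (is "?frame \<longleftrightarrow> ball 0 \<alpha> \<subseteq> closure ?D \<and> ?D \<subseteq> cball 0 \<beta>")
proof
  assume frame: ?frame
  have summable: "(\<lambda>i. (hs_norm E (G i x))\<^sup>2) summable_on I" for x
    using frame by (simp add: hs_frame_def)
  have lower: "\<alpha>\<^sup>2 * (norm x)\<^sup>2 \<le> (\<Sum>\<^sub>\<infinity>i\<in>I. (hs_norm E (G i x))\<^sup>2)" for x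
    using frame by (simp add: hs_frame_def)
  have upper: "(\<Sum>\<^sub>\<infinity>i\<in>I. (hs_norm E (G i x))\<^sup>2) \<le> \<beta>\<^sup>2 * (norm x)\<^sup>2" for x
    using frame by (simp add: hs_frame_def)
  show "ball 0 \<alpha> \<subseteq> closure ?D \<and> ?D \<subseteq> cball 0 \<beta>"
  proof (intro conjI subsetI)
    fix d assume "d \<in> ?D"
    obtain J where J: "finite J" "J \<subseteq> I"
        "\<forall>x. inner x d \<le> sqrt (\<Sum>i\<in>J. (hs_norm E (G i x))\<^sup>2)"
      using inner_unit_synthesis_le[OF G \<open>d \<in> ?D\<close>] .
    have "(\<Sum>i\<in>J. (hs_norm E (G i d))\<^sup>2) \<le> (\<Sum>\<^sub>\<infinity>i\<in>I. (hs_norm E (G i d))\<^sup>2)"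
      using J summable by (intro finite_sum_le_infsum) auto
    also have "\<dots> \<le> (\<beta> * norm d)\<^sup>2" using upper by (simp add: power_mult_distrib)
    finally have "sqrt (\<Sum>i\<in>J. (hs_norm E (G i d))\<^sup>2) \<le> \<beta> * norm d"
      using \<beta> by (simp add: real_le_lsqrt)
    with J(3)[rule_format, of d] have "norm d * norm d \<le> \<beta> * norm d"
      unfolding dot_square_norm power2_eq_square by (rule order_trans)
    then show "d \<in> cball 0 \<beta>"
      using \<beta> by (cases "d = 0") auto
  next
    fix y :: 'h assume y: "y \<in> ball 0 \<alpha>"
    show "y \<in> closure ?D"
    proof (rule ccontr)
      assume "y \<notin> closure ?D"
      then obtain w m where m: "\<forall>d\<in>?D. inner w d \<le> m" and wy: "m < inner w y"
        by (rule separation_from_closure[OF convex_unit_synthesis[OF G]])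
      have sum_le: "sqrt (\<Sum>i\<in>J. (hs_norm E (G i w))\<^sup>2) \<le> m" if "finite J" "J \<subseteq> I" for J
      proof -
        obtain d where "d \<in> ?D" "inner w d = sqrt (\<Sum>i\<in>J. (hs_norm E (G i w))\<^sup>2)"
          using unit_synthesis_norming[OF G \<open>finite J\<close> \<open>J \<subseteq> I\<close>] .
        then show ?thesis using m by force
      qed
      have "m \<ge> 0" using sum_le[of "{}"] by simp
      have "(\<Sum>\<^sub>\<infinity>i\<in>I. (hs_norm E (G i w))\<^sup>2) \<le> m\<^sup>2"
        by (intro infsum_le_finite_sums summable sqrt_le_D sum_le)
      then have "(\<alpha> * norm w)\<^sup>2 \<le> m\<^sup>2"
        using lower[of w] by (simp add: power_mult_distrib)
      then have "\<alpha> * norm w \<le> m" using \<open>m \<ge> 0\<close> by (rule power2_le_imp_le)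
      also have "m < norm w * norm y"
        using wy norm_cauchy_schwarz[of w y] by linarith
      also have "\<dots> \<le> norm w * \<alpha>" using y by (intro mult_left_mono) auto
      finally show False by (simp add: mult.commute)
    qed
  qed
next
  assume D: "ball 0 \<alpha> \<subseteq> closure ?D \<and> ?D \<subseteq> cball 0 \<beta>"
  have sum_le: "(\<Sum>i\<in>J. (hs_norm E (G i x))\<^sup>2) \<le> \<beta>\<^sup>2 * (norm x)\<^sup>2" if J: "finite J" "J \<subseteq> I" for J x
  proof -
    obtain d where d: "d \<in> ?D" "inner x d = sqrt (\<Sum>i\<in>J. (hs_norm E (G i x))\<^sup>2)"
      using unit_synthesis_norming[OF G J] .
    have "inner x d \<le> norm x * \<beta>"
    proof (rule order_trans[OF norm_cauchy_schwarz])
      show "norm x * norm d \<le> norm x * \<beta>" using d(1) D by (intro mult_left_mono) auto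
    qed
    then have "(\<Sum>i\<in>J. (hs_norm E (G i x))\<^sup>2) \<le> (norm x * \<beta>)\<^sup>2"
      unfolding d(2) by (rule sqrt_le_D)
    then show ?thesis by (simp add: power_mult_distrib mult.commute)
  qed
  have summable: "(\<lambda>i. (hs_norm E (G i x))\<^sup>2) summable_on I" for x
    using sum_le[of _ x] by (intro nonneg_bdd_above_summable_on) (auto simp: bdd_above_def)
  have "\<alpha>\<^sup>2 * (norm x)\<^sup>2 \<le> (\<Sum>\<^sub>\<infinity>i\<in>I. (hs_norm E (G i x))\<^sup>2)" for x
  proof -
    define q where "q = (\<Sum>\<^sub>\<infinity>i\<in>I. (hs_norm E (G i x))\<^sup>2)"
    have "?D \<subseteq> {d. inner x d \<le> sqrt q}"
    proof
      fix d assume "d \<in> ?D"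
      obtain J where J: "finite J" "J \<subseteq> I"
          "\<forall>x. inner x d \<le> sqrt (\<Sum>i\<in>J. (hs_norm E (G i x))\<^sup>2)"
        using inner_unit_synthesis_le[OF G \<open>d \<in> ?D\<close>] .
      have "(\<Sum>i\<in>J. (hs_norm E (G i x))\<^sup>2) \<le> q"
        unfolding q_def using J summable by (intro finite_sum_le_infsum) auto
      then show "d \<in> {d. inner x d \<le> sqrt q}"
        using order_trans[OF J(3)[rule_format] real_sqrt_le_mono] by simp
    qed
    then have "closure ?D \<subseteq> {d. inner x d \<le> sqrt q}"
      by (intro closure_minimal closed_Collect_le continuous_intros)
    then have ball: "inner x y \<le> sqrt q" if "norm y < \<alpha>" for y
      using D that by auto
    have "\<alpha> * norm x \<le> sqrt q"
    proof (cases "x = 0")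
      case False
      have "s \<le> sqrt q / norm x" if "0 < s" "s < \<alpha>" for s
        using ball[of "(s / norm x) *\<^sub>R x"] that False
        by (simp add: pos_le_divide_eq dot_square_norm power2_eq_square)
      then have "\<alpha> \<le> sqrt q / norm x" by (rule dense_le_bounded[OF \<alpha>])
      then show ?thesis using False by (simp add: pos_le_divide_eq)
    qed (simp add: q_def infsum_nonneg)
    then have "(\<alpha> * norm x)\<^sup>2 \<le> (sqrt q)\<^sup>2"
      using \<alpha> by (intro power_mono) auto
    then show ?thesis
      by (simp add: power_mult_distrib q_def infsum_nonneg)
  qed
  moreover have "(\<Sum>\<^sub>\<infinity>i\<in>I. (hs_norm E (G i x))\<^sup>2) \<le> \<beta>\<^sup>2 * (norm x)\<^sup>2" for x
    using sum_le by (intro infsum_le_finite_sums summable)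
  ultimately show ?frame
    using G summable \<alpha> \<beta> by (simp add: hs_frame_def)
qed

section \<open>Perturbation of frames\<close>

text \<open>The linear case of the theorem. The pairs that come from families in the unit ball project onto
  the synthesised unit balls of \<open>G\<close> and \<open>H\<close>, so the abstract perturbation results transport both
  inclusions that characterise frames.\<close>
lemma hs_frame_perturbation:
  fixes G H :: "'i \<Rightarrow> 'h::complex_hilbert \<Rightarrow> 'k::complex_inner \<Rightarrow> 'k"
  assumes frame: "hs_frame E I G A B"
    and H: "\<forall>i\<in>I. hs_bounded_linear E (H i)"
    and \<mu>: "0 \<le> \<mu>\<^sub>1" "\<mu>\<^sub>1 < 1" "0 \<le> \<mu>\<^sub>2" "\<mu>\<^sub>2 < 1"
    and close: "\<And>J T. hs_family E I J T \<Longrightarrow> norm (synthesis E G J T - synthesis E H J T)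
        \<le> \<mu>\<^sub>1 * norm (synthesis E G J T) + \<mu>\<^sub>2 * norm (synthesis E H J T)"
  shows "hs_frame E I H (A * ((1 - \<mu>\<^sub>1) / (1 + \<mu>\<^sub>2))\<^sup>2) (B * ((1 + \<mu>\<^sub>1) / (1 - \<mu>\<^sub>2))\<^sup>2)"
proof -
  have G: "\<forall>i\<in>I. hs_bounded_linear E (G i)" and AB: "A > 0" "B > 0"
    using frame by (auto simp: hs_frame_def)
  define \<alpha> where "\<alpha> = sqrt A * ((1 - \<mu>\<^sub>1) / (1 + \<mu>\<^sub>2))"
  define \<beta> where "\<beta> = sqrt B * ((1 + \<mu>\<^sub>1) / (1 - \<mu>\<^sub>2))"
  have pos: "\<alpha> > 0" "\<beta> > 0"
    using AB \<mu> by (auto simp: \<alpha>_def \<beta>_def)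
  have "hs_frame E I G ((sqrt A)\<^sup>2) ((sqrt B)\<^sup>2)"
    using frame AB by simp
  then have D_G: "ball 0 (sqrt A) \<subseteq> closure (unit_synthesis E I G)"
      "unit_synthesis E I G \<subseteq> cball 0 (sqrt B)"
    using hs_frame_iff_unit_synthesis[OF G, where \<alpha> = "sqrt A" and \<beta> = "sqrt B"] AB by auto
  define P where "P = synthesis_pairs E I G H"
  define C where "C = {(synthesis E G J T, synthesis E H J T) |J T.
      hs_family E I J T \<and> (\<Sum>i\<in>J. (hs_norm E (T i))\<^sup>2) \<le> 1}"
  have "C \<subseteq> P" by (auto simp: C_def P_def synthesis_pairs_def)
  have fst_C: "fst ` C = unit_synthesis E I G" and snd_C: "snd ` C = unit_synthesis E I H"
    unfolding C_def unit_synthesis_def by (force simp: image_iff)+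
  have close_P: "norm (a - b) \<le> \<mu>\<^sub>1 * norm a + \<mu>\<^sub>2 * norm b" if "(a, b) \<in> P" for a b
    using that close by (auto simp: P_def synthesis_pairs_def)
  have "ball 0 \<alpha> \<subseteq> closure (unit_synthesis E I H)"
    unfolding \<alpha>_def snd_C[symmetric]
  proof (rule ball_in_closure_image_perturbation[OF _ \<open>C \<subseteq> P\<close> \<mu> close_P])
    show "subspace P" unfolding P_def by (rule subspace_synthesis_pairs[OF G H])
  qed (use AB D_G fst_C in auto)
  moreover have "unit_synthesis E I H \<subseteq> cball 0 \<beta>"
  proof
    fix b assume "b \<in> unit_synthesis E I H"
    then obtain a where ab: "(a, b) \<in> C" unfolding snd_C[symmetric] by force
    then have "norm a \<le> sqrt B" using D_G(2) fst_C by force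
    then have "(1 + \<mu>\<^sub>1) / (1 - \<mu>\<^sub>2) * norm a \<le> \<beta>"
      unfolding \<beta>_def using \<mu> by (subst mult.commute, intro mult_right_mono) auto
    moreover have "norm b \<le> (1 + \<mu>\<^sub>1) / (1 - \<mu>\<^sub>2) * norm a"
      using ab \<open>C \<subseteq> P\<close> \<mu> by (intro norm_le_perturbed_norm close_P) auto
    ultimately show "b \<in> cball 0 \<beta>" by simp
  qed
  ultimately have "hs_frame E I H (\<alpha>\<^sup>2) (\<beta>\<^sup>2)"
    using hs_frame_iff_unit_synthesis[OF H pos] by blast
  then show ?thesis
    using AB by (simp only: \<alpha>_def \<beta>_def power_mult_distrib real_sqrt_pow2 less_imp_le)
qed

theorem theorem4p4:
  fixes E :: "'k::complex_hilbert set"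
    and I :: "'i set"
    and G H :: "'i \<Rightarrow> 'h::complex_hilbert \<Rightarrow> 'k \<Rightarrow> 'k"
    and A B :: real
  assumes "separable_space (euclidean :: 'h topology)"
    and "separable_space (euclidean :: 'k topology)"
    and "is_onb E"
    and "countable I"
    and "hs_frame E I G A B"
    and "\<forall>i\<in>I. hs_bounded_linear E (H i)"
    and "\<forall>k>0. \<exists>l1 l2. perturbation_constants E I G H k l1 l2"
  shows "(\<exists>A' B'. hs_frame E I H A' B') \<and>
    (\<forall>k>0. \<forall>l1 l2. perturbation_constants E I G H k l1 l2 \<longrightarrow>
       hs_frame E I H
         (A * ((1 - pert_c k powr (1/k) * l1 powr (1/k)) / (1 + pert_c k powr (1/k) * l2 powr (1/k)))\<^sup>2)
         (B * ((1 + pert_c k powr (1/k) * l1 powr (1/k)) / (1 - pert_c k powr (1/k) * l2 powr (1/k)))\<^sup>2))"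
proof -
  have frame: "hs_frame E I H
      (A * ((1 - pert_c k powr (1/k) * l1 powr (1/k)) / (1 + pert_c k powr (1/k) * l2 powr (1/k)))\<^sup>2)
      (B * ((1 + pert_c k powr (1/k) * l1 powr (1/k)) / (1 - pert_c k powr (1/k) * l2 powr (1/k)))\<^sup>2)"
    if "k > 0" and pert: "perturbation_constants E I G H k l1 l2" for k l1 l2
  proof (rule hs_frame_perturbation[OF assms(5)])
    have l: "0 \<le> l1" "0 \<le> l2" "l1 < min 1 (2 powr (k - 1))" "l2 < min 1 (2 powr (k - 1))"
      using pert by (auto simp: perturbation_constants_def)
    show "0 \<le> pert_c k powr (1/k) * l1 powr (1/k)" "0 \<le> pert_c k powr (1/k) * l2 powr (1/k)"
      by simp_all
    show "pert_c k powr (1/k) * l1 powr (1/k) < 1" "pert_c k powr (1/k) * l2 powr (1/k) < 1"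
      using pert_constant_less_1[OF \<open>k > 0\<close>] l by blast+
    fix J T assume "hs_family E I J T"
    then have "norm (synthesis E G J T - synthesis E H J T) powr k
        \<le> l1 * norm (synthesis E G J T) powr k + l2 * norm (synthesis E H J T) powr k"
      using pert by (simp add: perturbation_constants_def hs_family_def synthesis_def
          sum_subtractf[symmetric])
    then show "norm (synthesis E G J T - synthesis E H J T)
        \<le> pert_c k powr (1/k) * l1 powr (1/k) * norm (synthesis E G J T)
          + pert_c k powr (1/k) * l2 powr (1/k) * norm (synthesis E H J T)"
      using l \<open>k > 0\<close> by (intro powr_inequality_linearized) auto
  qed (use assms(6) in blast)
  moreover obtain l1 l2 where "perturbation_constants E I G H 1 l1 l2"
    using assms(7) zero_less_one by blast
  ultimately show ?thesis using zero_less_one by blast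
qed

end
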